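(* In every degenerate geometric algebra $C\ell_{p,q,r}$, $p+q+r=n\ge1$, $r\neq0$, the groups $A^{\overline{01}}_{p,q,r}$, $A^{\overline{23}}_{p,q,r}$, $\check A^{\overline{12}}_{p,q,r}$, $\check A^{\overline{03}}_{p,q,r}$ and $\check A_{p,q,r}$ (defined in the context) are related by $$\check A^{\overline{03}}_{p,q,r}=\check A_{p,q,r}\,(Z^3_{p,q,r}\cap C\ell^{(0)}_{p,q,r})^{\times},$$ $$\check A^{\overline{12}}_{p,q,r}=\check A_{p,q,r}\,(\check Z^1_{p,q,r}\cap\check Z^2_{p,q,r})^{\times},\qquad A^{\overline{23}}_{p,q,r}=A^{\overline{01}}_{p,q,r}\,(Z^2_{p,q,r}\cap Z^3_{p,q,r})^{\times},$$ $$A^{\overline{01}}_{p,q,r}=\check A_{p,q,r}\,Z^{\times}_{p,q,r},$$ where for sets $G,H$ the product $GH$ denotes $\{gh:\ g\in G,\ h\in H\}$.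
   Context: $C\ell_{p,q,r}$, $p+q+r=n\ge1$, is the Clifford (geometric) algebra over the real space $\mathbb{R}^{p,q,r}$ or the complex space $\mathbb{C}^{p+q,0,r}$ (field $\mathbb{F}=\mathbb{R}$ or $\mathbb{C}$ respectively), with identity $e$ and generators $e_1,\dots,e_n$ satisfying $e_ae_b+e_be_a=2\eta_{ab}e$, where $\eta$ is diagonal with $p$ entries $+1$, then $q$ entries $-1$, then $r$ entries $0$ (in the complex case, $p+q$ entries $+1$ and $r$ entries $0$). $C\ell^k_{p,q,r}$ is the grade-$k$ subspace, spanned by $e_{a_1}\cdots e_{a_k}$, $a_1<\dots<a_k$ (it is $\{0\}$ for $k<0$ or $k>n$). $\Lambda_r=C\ell_{0,0,r}$ is the Grassmann subalgebra generated by the $r$ null generators $e_{p+q+1},\dots,e_n$. $\widehat U$ is the grade involution (multiplication by $(-1)^k$ on grade $k$), $\widetilde U$ is the reversion (multiplication by $(-1)^{k(k-1)/2}$ on grade $k$, an anti-automorphism). $C\ell^{(0)}_{p,q,r}$ is the even subspace and $\Lambda^{(0)}_r=\Lambda_r\cap C\ell^{(0)}_{p,q,r}$. For a subset $H\subseteq C\ell_{p,q,r}$, $H^\times$ denotes the set of invertible elements of $H$. $Z_{p,q,r}$ is the center of $C\ell_{p,q,r}$. Centralizers and twisted centralizers of grade subspaces: $Z^m_{p,q,r}=\{X\in C\ell_{p,q,r}:\ XV=VX\ \ \forall V\in C\ell^m_{p,q,r}\}$ and $\check Z^m_{p,q,r}=\{X\in C\ell_{p,q,r}:\ \widehat XV=VX\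 \ \forall V\in C\ell^m_{p,q,r}\}$ (if $m>n$, then $C\ell^m_{p,q,r}=\{0\}$ and both are all of $C\ell_{p,q,r}$). One has $Z^1_{p,q,r}=Z_{p,q,r}$. Groups: $A^{\overline{01}}_{p,q,r}=\{T\in C\ell^\times_{p,q,r}:\ \widetilde TT\in Z^{1\times}_{p,q,r}\}$, $A^{\overline{23}}_{p,q,r}=\{T\in C\ell^\times_{p,q,r}:\ \widetilde TT\in(Z^2_{p,q,r}\cap Z^3_{p,q,r})^\times\}$, $\check A^{\overline{12}}_{p,q,r}=\{T\in C\ell^\times_{p,q,r}:\ \widetilde TT\in(\check Z^1_{p,q,r}\cap\check Z^2_{p,q,r})^\times\}$, $\check A^{\overline{03}}_{p,q,r}=\{T\in C\ell^\times_{p,q,r}:\ \widetilde TT\in(Z^3_{p,q,r}\cap C\ell^{(0)}_{p,q,r})^\times\}$, $\check A_{p,q,r}=\{T\in C\ell^\times_{p,q,r}:\ \widetilde TT\in\Lambda^{(0)\times}_r\}$. *)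

theory Defs
  imports Complex_Main "HOL-Algebra.Coset" "HOL-Algebra.Ring"
begin

text \<open>
  The generators are indexed by 1, ..., n. A multivector is given by its coordinates in the
  basis of ordered products of generators: the value at A is the coefficient of the product of
  the generators with index in A, taken in increasing order. The argument \<open>\<eta>\<close> is the
  diagonal of the metric. That this is the algebra with the usual generators and
  relations is proved below (\<open>ring_clifford\<close>, \<open>scale_mult_clifford\<close>,
  \<open>generator_anticommute\<close>, \<open>blade_eq_ordered_product\<close>, \<open>multivector_expansion\<close>).
\<close>

type_synonym 'a multivector = "nat set \<Rightarrow> 'a"

definition metric_real :: "nat \<Rightarrow> nat \<Rightarrow> nat \<Rightarrow> real" where
  "metric_real p q i = (if i \<le> p then 1 else if i \<le> p + q then - 1 else 0)"

definition metric_complex :: "nat \<Rightarrow> nat \<Rightarrow> nat \<Rightarrow> complex" where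
  "metric_complex p q i = (if i \<le> p + q then 1 else 0)"

definition blade :: "nat set \<Rightarrow> 'a::field multivector" where
  "blade A = (\<lambda>B. if B = A then 1 else 0)"

abbreviation generator :: "nat \<Rightarrow> 'a::field multivector" where
  "generator i \<equiv> blade {i}"

definition scale :: "'a::field \<Rightarrow> 'a multivector \<Rightarrow> 'a multivector" where
  "scale c X = (\<lambda>A. c * X A)"

text \<open>
  The product of the blades of A and B is a multiple of the blade of their symmetric difference.
  The sign counts the transpositions needed to sort the concatenated product; each common index
  contributes the square of its generator.
\<close>

definition blade_coeff :: "(nat \<Rightarrow> 'a::field) \<Rightarrow> nat set \<Rightarrow> nat set \<Rightarrow> 'a" where
  "blade_coeff \<eta> A B = (-1) ^ card {(a, b). a \<in> A \<and> b \<in> B \<and> b < a} * (\<Prod>i\<in>A \<inter> B. \<eta> i)"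

definition clifford :: "(nat \<Rightarrow> 'a::field) \<Rightarrow> nat \<Rightarrow> 'a multivector ring" where
  "clifford \<eta> n =
    \<lparr>carrier = {X. \<forall>A. X A \<noteq> 0 \<longrightarrow> A \<subseteq> {1..n}},
     mult = (\<lambda>X Y C. \<Sum>A\<in>Pow {1..n}. \<Sum>B\<in>Pow {1..n}.
              if sym_diff A B = C then blade_coeff \<eta> A B * X A * Y B else 0),
     one = blade {},
     zero = (\<lambda>A. 0),
     add = (\<lambda>X Y A. X A + Y A)\<rparr>"

definition grade_subspace :: "(nat \<Rightarrow> 'a::field) \<Rightarrow> nat \<Rightarrow> nat \<Rightarrow> 'a multivector set" where
  "grade_subspace \<eta> n k = {X \<in> carrier (clifford \<eta> n). \<forall>A. X A \<noteq> 0 \<longrightarrow> card A = k}"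

definition even_subspace :: "(nat \<Rightarrow> 'a::field) \<Rightarrow> nat \<Rightarrow> 'a multivector set" where
  "even_subspace \<eta> n = {X \<in> carrier (clifford \<eta> n). \<forall>A. X A \<noteq> 0 \<longrightarrow> even (card A)}"

definition grade_involution :: "'a::field multivector \<Rightarrow> 'a multivector" where
  "grade_involution X = (\<lambda>A. (-1) ^ card A * X A)"

definition reversion :: "'a::field multivector \<Rightarrow> 'a multivector" where
  "reversion X = (\<lambda>A. (-1) ^ (card A * (card A - 1) div 2) * X A)"

text \<open>
  For the two metrics above and n = p + q + r, the indices in \<open>{1..n}\<close> at which the metric
  vanishes are the last r, so this is the unital subalgebra generated by the r null generators;
  \<open>grassmann_eq_span\<close> below describes it in coordinates.
\<close>

inductive_set grassmann :: "(nat \<Rightarrow> 'a::field) \<Rightarrow> nat \<Rightarrow> 'a multivector set"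
  for \<eta> :: "nat \<Rightarrow> 'a" and n :: nat
where
  one: "\<one>\<^bsub>clifford \<eta> n\<^esub> \<in> grassmann \<eta> n"
| generator: "i \<in> {1..n} \<Longrightarrow> \<eta> i = 0 \<Longrightarrow> generator i \<in> grassmann \<eta> n"
| scale: "X \<in> grassmann \<eta> n \<Longrightarrow> scale c X \<in> grassmann \<eta> n"
| add: "X \<in> grassmann \<eta> n \<Longrightarrow> Y \<in> grassmann \<eta> n \<Longrightarrow> X \<oplus>\<^bsub>clifford \<eta> n\<^esub> Y \<in> grassmann \<eta> n"
| mult: "X \<in> grassmann \<eta> n \<Longrightarrow> Y \<in> grassmann \<eta> n \<Longrightarrow> X \<otimes>\<^bsub>clifford \<eta> n\<^esub> Y \<in> grassmann \<eta> n"

definition even_grassmann :: "(nat \<Rightarrow> 'a::field) \<Rightarrow> nat \<Rightarrow> 'a multivector set" where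
  "even_grassmann \<eta> n = grassmann \<eta> n \<inter> even_subspace \<eta> n"

text \<open>The inverse is sought in the whole algebra and need not lie in H.\<close>

definition invertibles :: "(nat \<Rightarrow> 'a::field) \<Rightarrow> nat \<Rightarrow> 'a multivector set \<Rightarrow> 'a multivector set" where
  "invertibles \<eta> n H = H \<inter> Units (clifford \<eta> n)"

definition center :: "(nat \<Rightarrow> 'a::field) \<Rightarrow> nat \<Rightarrow> 'a multivector set" where
  "center \<eta> n = {X \<in> carrier (clifford \<eta> n).
     \<forall>V\<in>carrier (clifford \<eta> n). X \<otimes>\<^bsub>clifford \<eta> n\<^esub> V = V \<otimes>\<^bsub>clifford \<eta> n\<^esub> X}"

definition centralizer :: "(nat \<Rightarrow> 'a::field) \<Rightarrow> nat \<Rightarrow> nat \<Rightarrow> 'a multivector set" where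
  "centralizer \<eta> n m = {X \<in> carrier (clifford \<eta> n).
     \<forall>V\<in>grade_subspace \<eta> n m. X \<otimes>\<^bsub>clifford \<eta> n\<^esub> V = V \<otimes>\<^bsub>clifford \<eta> n\<^esub> X}"

definition twisted_centralizer :: "(nat \<Rightarrow> 'a::field) \<Rightarrow> nat \<Rightarrow> nat \<Rightarrow> 'a multivector set" where
  "twisted_centralizer \<eta> n m = {X \<in> carrier (clifford \<eta> n).
     \<forall>V\<in>grade_subspace \<eta> n m.
       grade_involution X \<otimes>\<^bsub>clifford \<eta> n\<^esub> V = V \<otimes>\<^bsub>clifford \<eta> n\<^esub> X}"

definition group_A01 :: "(nat \<Rightarrow> 'a::field) \<Rightarrow> nat \<Rightarrow> 'a multivector set" where
  "group_A01 \<eta> n = {T \<in> Units (clifford \<eta> n).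
     reversion T \<otimes>\<^bsub>clifford \<eta> n\<^esub> T \<in> invertibles \<eta> n (centralizer \<eta> n 1)}"

definition group_A23 :: "(nat \<Rightarrow> 'a::field) \<Rightarrow> nat \<Rightarrow> 'a multivector set" where
  "group_A23 \<eta> n = {T \<in> Units (clifford \<eta> n).
     reversion T \<otimes>\<^bsub>clifford \<eta> n\<^esub> T
       \<in> invertibles \<eta> n (centralizer \<eta> n 2 \<inter> centralizer \<eta> n 3)}"

definition group_check_A12 :: "(nat \<Rightarrow> 'a::field) \<Rightarrow> nat \<Rightarrow> 'a multivector set" where
  "group_check_A12 \<eta> n = {T \<in> Units (clifford \<eta> n).
     reversion T \<otimes>\<^bsub>clifford \<eta> n\<^esub> T
       \<in> invertibles \<eta> n (twisted_centralizer \<eta> n 1 \<inter> twisted_centralizer \<eta> n 2)}"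

definition group_check_A03 :: "(nat \<Rightarrow> 'a::field) \<Rightarrow> nat \<Rightarrow> 'a multivector set" where
  "group_check_A03 \<eta> n = {T \<in> Units (clifford \<eta> n).
     reversion T \<otimes>\<^bsub>clifford \<eta> n\<^esub> T
       \<in> invertibles \<eta> n (centralizer \<eta> n 3 \<inter> even_subspace \<eta> n)}"

definition group_check_A :: "(nat \<Rightarrow> 'a::field) \<Rightarrow> nat \<Rightarrow> 'a multivector set" where
  "group_check_A \<eta> n = {T \<in> Units (clifford \<eta> n).
     reversion T \<otimes>\<^bsub>clifford \<eta> n\<^esub> T \<in> invertibles \<eta> n (even_grassmann \<eta> n)}"

lemma finite_index: "A \<subseteq> {1..n::nat} \<Longrightarrow> finite A"
  using finite_subset by blast

lemma carrier_clifford_iff: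
  "X \<in> carrier (clifford \<eta> n) \<longleftrightarrow> (\<forall>A. X A \<noteq> 0 \<longrightarrow> A \<subseteq> {1..n})"
  by (simp add: clifford_def)

lemma clifford_simps:
  "\<one>\<^bsub>clifford \<eta> n\<^esub> = blade {}" "\<zero>\<^bsub>clifford \<eta> n\<^esub> = (\<lambda>A. 0)"
  "X \<oplus>\<^bsub>clifford \<eta> n\<^esub> Y = (\<lambda>A. X A + Y A)"
  by (simp_all add: clifford_def)

lemma mult_clifford_outside:
  assumes "\<not> C \<subseteq> {1..n}"
  shows "(X \<otimes>\<^bsub>clifford \<eta> n\<^esub> Y) C = 0"
proof -
  have "sym_diff A B \<noteq> C" if "A \<in> Pow {1..n}" "B \<in> Pow {1..n}" for A B
    using that assms by blast
  then show ?thesis by (simp add: clifford_def)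
qed

lemma mult_clifford_nth:
  assumes "C \<subseteq> {1..n}"
  shows "(X \<otimes>\<^bsub>clifford \<eta> n\<^esub> Y) C =
    (\<Sum>A\<in>Pow {1..n}. blade_coeff \<eta> A (sym_diff A C) * X A * Y (sym_diff A C))"
proof -
  have "(\<Sum>B\<in>Pow {1..n}. if sym_diff A B = C then blade_coeff \<eta> A B * X A * Y B else 0) =
      blade_coeff \<eta> A (sym_diff A C) * X A * Y (sym_diff A C)" if A: "A \<in> Pow {1..n}" for A
  proof -
    have eq: "sym_diff A B = C \<longleftrightarrow> B = sym_diff A C" for B by blast
    have "sym_diff A C \<in> Pow {1..n}" using A assms by blast
    then show ?thesis unfolding eq by (subst sum.delta) simp_all
  qed
  then show ?thesis by (simp add: clifford_def)
qed

lemma prod_sym_diff: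
  fixes f :: "nat \<Rightarrow> 'a::comm_ring_1"
  assumes "finite A" "finite B" "\<And>i. f i * f i = 1"
  shows "prod f (sym_diff A B) = prod f A * prod f B"
proof -
  have A: "prod f A = prod f (A - B) * prod f (A \<inter> B)"
    using assms(1) by (metis Int_Diff_Un Int_Diff_disjoint Un_commute finite_Diff finite_Int prod.union_disjoint mult.commute)
  have B: "prod f B = prod f (B - A) * prod f (A \<inter> B)"
    using assms(2) by (metis Int_Diff_Un Int_Diff_disjoint Int_commute finite_Diff finite_Int prod.union_disjoint mult.commute)
  have I: "prod f (A \<inter> B) * prod f (A \<inter> B) = 1"
    by (simp add: prod.distrib[symmetric] assms(3))
  have "prod f (sym_diff A B) = prod f (A - B) * prod f (B - A)"
    using assms by (subst prod.union_disjoint) auto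
  also have "\<dots> = prod f (A - B) * prod f (B - A) * (prod f (A \<inter> B) * prod f (A \<inter> B))"
    by (simp add: I)
  finally show ?thesis by (simp add: A B mult_ac)
qed

lemma inversion_sign:
  assumes "finite A" "finite B"
  shows "(-1 :: 'a::field) ^ card {(a, b). a \<in> A \<and> b \<in> B \<and> b < a} =
    (\<Prod>a\<in>A. \<Prod>b\<in>B. if b < a then -1 else 1)"
proof -
  have "(\<Prod>a\<in>A. \<Prod>b\<in>B. if b < a then -1 else (1::'a)) =
      (\<Prod>x\<in>A \<times> B. if snd x < fst x then -1 else 1)"
    by (simp add: prod.cartesian_product case_prod_unfold)
  also have "\<dots> = (\<Prod>x\<in>{x \<in> A \<times> B. snd x < fst x}. -1)"
    using assms by (subst prod.inter_filter) auto
  also have "{x \<in> A \<times> B. snd x < fst x} = {(a, b). a \<in> A \<and> b \<in> B \<and> b < a}" by auto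
  finally show ?thesis by simp
qed

lemma blade_coeff_cocycle:
  fixes \<eta> :: "nat \<Rightarrow> 'a::field"
  assumes "finite A" "finite B" "finite C"
  shows "blade_coeff \<eta> A B * blade_coeff \<eta> (sym_diff A B) C =
    blade_coeff \<eta> A (sym_diff B C) * blade_coeff \<eta> B C"
proof -
  define s :: "nat set \<Rightarrow> nat set \<Rightarrow> 'a" where
    "s A B = (\<Prod>a\<in>A. \<Prod>b\<in>B. if b < a then -1 else 1)" for A B
  define h where "h A B = (\<Prod>i\<in>A \<inter> B. \<eta> i)" for A B
  have coeff: "blade_coeff \<eta> A B = s A B * h A B" if "finite A" "finite B" for A B
    using inversion_sign[OF that, where 'a='a] by (simp add: blade_coeff_def s_def h_def)
  have sq: "(\<Prod>b\<in>B. if b < a then -1 else (1::'a)) * (\<Prod>b\<in>B. if b < a then -1 else 1) = 1"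
    for a :: nat and B
    by (simp add: prod.distrib[symmetric] prod.neutral)
  have s1: "s (sym_diff A B) C = s A C * s B C"
    unfolding s_def using assms sq by (intro prod_sym_diff) auto
  have s2: "s A (sym_diff B C) = s A B * s A C"
    unfolding s_def prod.distrib[symmetric]
    using assms by (intro prod.cong refl prod_sym_diff) auto
  have pt: "h X Y = (\<Prod>i\<in>A \<union> B \<union> C. if i \<in> X \<inter> Y then \<eta> i else 1)"
    if "X \<inter> Y \<subseteq> A \<union> B \<union> C" for X Y
    unfolding h_def using that assms
    by (subst prod.inter_restrict[symmetric]) (auto intro!: prod.cong)
  have "h A B * h (sym_diff A B) C = h A (sym_diff B C) * h B C"
    by (subst (1 2 3 4) pt) (auto simp: prod.distrib[symmetric] intro!: prod.cong)
  moreover have "blade_coeff \<eta> (sym_diff A B) C = s (sym_diff A B) C * h (sym_diff A B) C"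
    "blade_coeff \<eta> A (sym_diff B C) = s A (sym_diff B C) * h A (sym_diff B C)"
    using assms by (auto intro!: coeff)
  moreover have "blade_coeff \<eta> A B = s A B * h A B" "blade_coeff \<eta> B C = s B C * h B C"
    using assms by (auto intro!: coeff)
  ultimately show ?thesis using s1 s2 by (simp add: mult_ac)
qed

lemma blade_coeff_empty [simp]: "blade_coeff \<eta> {} B = 1" "blade_coeff \<eta> A {} = 1"
  by (simp_all add: blade_coeff_def)

lemma mult_clifford_closed: "X \<otimes>\<^bsub>clifford \<eta> n\<^esub> Y \<in> carrier (clifford \<eta> n)"
  using mult_clifford_outside unfolding carrier_clifford_iff by blast

lemma mult_clifford_assoc:
  "(X \<otimes>\<^bsub>clifford \<eta> n\<^esub> Y) \<otimes>\<^bsub>clifford \<eta> n\<^esub> Z = X \<otimes>\<^bsub>clifford \<eta> n\<^esub> (Y \<otimes>\<^bsub>clifford \<eta> n\<^esub> Z)"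
proof
  fix D
  let ?P = "Pow {1..n}" and ?b = "blade_coeff \<eta>"
  show "((X \<otimes>\<^bsub>clifford \<eta> n\<^esub> Y) \<otimes>\<^bsub>clifford \<eta> n\<^esub> Z) D = (X \<otimes>\<^bsub>clifford \<eta> n\<^esub> (Y \<otimes>\<^bsub>clifford \<eta> n\<^esub> Z)) D"
  proof (cases "D \<subseteq> {1..n}")
    case False
    then show ?thesis by (simp add: mult_clifford_outside)
  next
    case D: True
    have "((X \<otimes>\<^bsub>clifford \<eta> n\<^esub> Y) \<otimes>\<^bsub>clifford \<eta> n\<^esub> Z) D =
        (\<Sum>C\<in>?P. \<Sum>A\<in>?P. ?b C (sym_diff C D) *
          (?b A (sym_diff A C) * X A * Y (sym_diff A C)) * Z (sym_diff C D))"
      using D by (simp add: mult_clifford_nth sum_distrib_left sum_distrib_right)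
    also have "\<dots> = (\<Sum>A\<in>?P. \<Sum>C\<in>?P. ?b C (sym_diff C D) *
          (?b A (sym_diff A C) * X A * Y (sym_diff A C)) * Z (sym_diff C D))"
      by (rule sum.swap)
    also have "\<dots> = (\<Sum>A\<in>?P. \<Sum>B\<in>?P. ?b A (sym_diff A D) * X A *
          (?b B (sym_diff B (sym_diff A D)) * Y B * Z (sym_diff B (sym_diff A D))))"
    proof (rule sum.cong[OF refl])
      fix A assume A: "A \<in> ?P"
      show "(\<Sum>C\<in>?P. ?b C (sym_diff C D) *
          (?b A (sym_diff A C) * X A * Y (sym_diff A C)) * Z (sym_diff C D)) =
        (\<Sum>B\<in>?P. ?b A (sym_diff A D) * X A *
          (?b B (sym_diff B (sym_diff A D)) * Y B * Z (sym_diff B (sym_diff A D))))"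
      proof (rule sum.reindex_bij_witness[of _ "sym_diff A" "sym_diff A"])
        fix C assume C: "C \<in> ?P"
        let ?B = "sym_diff A C" and ?E = "sym_diff C D"
        have e: "sym_diff ?B (sym_diff A D) = ?E" "sym_diff A ?B = C" "sym_diff ?B ?E = sym_diff A D"
          by blast+
        have "finite A" "finite ?B" "finite ?E"
          using A C D finite_index by (auto intro: finite_subset)
        from blade_coeff_cocycle[OF this, of \<eta>]
        have "?b A ?B * ?b C ?E = ?b A (sym_diff A D) * ?b ?B ?E" unfolding e .
        then show "?b A (sym_diff A D) * X A *
            (?b ?B (sym_diff ?B (sym_diff A D)) * Y ?B * Z (sym_diff ?B (sym_diff A D))) =
          ?b C ?E * (?b A ?B * X A * Y ?B) * Z ?E"
          unfolding e by (simp add: mult_ac)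
      next
        fix B assume B: "B \<in> ?P"
        show "sym_diff A (sym_diff A B) = B" by blast
        show "sym_diff A B \<in> ?P" using A B by blast
      next
        fix C assume C: "C \<in> ?P"
        show "sym_diff A (sym_diff A C) = C" by blast
        show "sym_diff A C \<in> ?P" using A C by blast
      qed
    qed
    also have "\<dots> = (X \<otimes>\<^bsub>clifford \<eta> n\<^esub> (Y \<otimes>\<^bsub>clifford \<eta> n\<^esub> Z)) D"
    proof -
      have "sym_diff A D \<subseteq> {1..n}" if "A \<in> ?P" for A using that D by blast
      then show ?thesis unfolding mult_clifford_nth[OF D]
        by (intro sum.cong refl) (simp only: mult_clifford_nth sum_distrib_left)
    qed
    finally show ?thesis .
  qed
qed

lemma one_mult_clifford:
  assumes "X \<in> carrier (clifford \<eta> n)"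
  shows "blade {} \<otimes>\<^bsub>clifford \<eta> n\<^esub> X = X"
proof
  fix C
  show "(blade {} \<otimes>\<^bsub>clifford \<eta> n\<^esub> X) C = X C"
  proof (cases "C \<subseteq> {1..n}")
    case True
    have "(blade {} \<otimes>\<^bsub>clifford \<eta> n\<^esub> X) C = (\<Sum>A\<in>Pow {1..n}. if A = {} then X C else 0)"
      unfolding mult_clifford_nth[OF True] by (intro sum.cong) (auto simp: blade_def)
    then show ?thesis by simp
  next
    case False
    then show ?thesis using assms by (auto simp: mult_clifford_outside carrier_clifford_iff)
  qed
qed

lemma mult_one_clifford:
  assumes "X \<in> carrier (clifford \<eta> n)"
  shows "X \<otimes>\<^bsub>clifford \<eta> n\<^esub> blade {} = X"
proof
  fix C
  show "(X \<otimes>\<^bsub>clifford \<eta> n\<^esub> blade {}) C = X C"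
  proof (cases "C \<subseteq> {1..n}")
    case True
    have "sym_diff A C = {} \<longleftrightarrow> A = C" for A by blast
    then have "(X \<otimes>\<^bsub>clifford \<eta> n\<^esub> blade {}) C = (\<Sum>A\<in>Pow {1..n}. if A = C then X C else 0)"
      unfolding mult_clifford_nth[OF True] by (intro sum.cong) (auto simp: blade_def)
    then show ?thesis using True by simp
  next
    case False
    then show ?thesis using assms by (auto simp: mult_clifford_outside carrier_clifford_iff)
  qed
qed

lemma mult_clifford_distrib:
  "(\<lambda>A. X A + Y A) \<otimes>\<^bsub>clifford \<eta> n\<^esub> Z = (\<lambda>A. (X \<otimes>\<^bsub>clifford \<eta> n\<^esub> Z) A + (Y \<otimes>\<^bsub>clifford \<eta> n\<^esub> Z) A)"
  "Z \<otimes>\<^bsub>clifford \<eta> n\<^esub> (\<lambda>A. X A + Y A) = (\<lambda>A. (Z \<otimes>\<^bsub>clifford \<eta> n\<^esub> X) A + (Z \<otimes>\<^bsub>clifford \<eta> n\<^esub> Y) A)"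
  by (auto simp: clifford_def fun_eq_iff algebra_simps sum.distrib[symmetric] intro!: sum.cong)

theorem ring_clifford: "ring (clifford \<eta> n)"
proof (intro ringI abelian_groupI monoidI)
  fix X assume "X \<in> carrier (clifford \<eta> n)"
  then show "\<exists>Y\<in>carrier (clifford \<eta> n). Y \<oplus>\<^bsub>clifford \<eta> n\<^esub> X = \<zero>\<^bsub>clifford \<eta> n\<^esub>"
    by (intro bexI[of _ "\<lambda>A. - X A"]) (auto simp: carrier_clifford_iff clifford_simps)
next
  fix X Y assume "X \<in> carrier (clifford \<eta> n)" "Y \<in> carrier (clifford \<eta> n)"
  then show "X \<oplus>\<^bsub>clifford \<eta> n\<^esub> Y \<in> carrier (clifford \<eta> n)"
    unfolding carrier_clifford_iff clifford_simps by (metis add.right_neutral)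
next
  show "\<one>\<^bsub>clifford \<eta> n\<^esub> \<in> carrier (clifford \<eta> n)" "\<zero>\<^bsub>clifford \<eta> n\<^esub> \<in> carrier (clifford \<eta> n)"
    by (simp_all add: carrier_clifford_iff clifford_simps blade_def)
qed (simp_all add: mult_clifford_closed mult_clifford_assoc clifford_simps one_mult_clifford
       mult_one_clifford mult_clifford_distrib add_ac)

lemma scale_mult_clifford:
  "scale c X \<otimes>\<^bsub>clifford \<eta> n\<^esub> Y = scale c (X \<otimes>\<^bsub>clifford \<eta> n\<^esub> Y)"
  "X \<otimes>\<^bsub>clifford \<eta> n\<^esub> scale c Y = scale c (X \<otimes>\<^bsub>clifford \<eta> n\<^esub> Y)"
  by (auto simp: clifford_def scale_def fun_eq_iff sum_distrib_left algebra_simps intro!: sum.cong)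

lemma blade_mult_blade:
  assumes "A \<subseteq> {1..n}" "B \<subseteq> {1..n}"
  shows "blade A \<otimes>\<^bsub>clifford \<eta> n\<^esub> blade B = scale (blade_coeff \<eta> A B) (blade (sym_diff A B))"
proof
  fix C
  show "(blade A \<otimes>\<^bsub>clifford \<eta> n\<^esub> blade B) C = scale (blade_coeff \<eta> A B) (blade (sym_diff A B)) C"
  proof (cases "C \<subseteq> {1..n}")
    case True
    have eq: "sym_diff A C = B \<longleftrightarrow> C = sym_diff A B" by blast
    have "(blade A \<otimes>\<^bsub>clifford \<eta> n\<^esub> blade B) C =
        (\<Sum>A'\<in>Pow {1..n}. if A' = A then blade_coeff \<eta> A (sym_diff A C) * blade B (sym_diff A C) else 0)"
      unfolding mult_clifford_nth[OF True] by (intro sum.cong) (auto simp: blade_def)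
    also have "\<dots> = blade_coeff \<eta> A (sym_diff A C) * blade B (sym_diff A C)"
      using assms by simp
    also have "\<dots> = scale (blade_coeff \<eta> A B) (blade (sym_diff A B)) C"
      using eq by (auto simp: blade_def scale_def)
    finally show ?thesis .
  next
    case False
    then have "C \<noteq> sym_diff A B" using assms by blast
    then show ?thesis using False by (simp add: mult_clifford_outside scale_def blade_def)
  qed
qed

theorem generator_anticommute:
  assumes "a \<in> {1..n}" "b \<in> {1..n}"
  shows "generator a \<otimes>\<^bsub>clifford \<eta> n\<^esub> generator b \<oplus>\<^bsub>clifford \<eta> n\<^esub> generator b \<otimes>\<^bsub>clifford \<eta> n\<^esub> generator a
    = scale (2 * (if a = b then \<eta> a else 0)) \<one>\<^bsub>clifford \<eta> n\<^esub>"
proof -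
  have c: "blade_coeff \<eta> {x} {y} = (if y < x then -1 else if x = y then \<eta> x else 1)" for x y
  proof -
    have "{(a, b). a = x \<and> b = y \<and> b < a} = (if y < x then {(x, y)} else {})" by auto
    then show ?thesis by (auto simp: blade_coeff_def)
  qed
  have "sym_diff {b} {a} = sym_diff {a} {b}" by blast
  then show ?thesis
    using assms
    by (cases a b rule: linorder_cases)
      (simp_all add: blade_mult_blade c clifford_simps, auto simp: scale_def fun_eq_iff)
qed

theorem blade_eq_ordered_product:
  assumes "A \<subseteq> {1..n}"
  shows "blade A = foldr (\<lambda>i X. generator i \<otimes>\<^bsub>clifford \<eta> n\<^esub> X) (sorted_list_of_set A) \<one>\<^bsub>clifford \<eta> n\<^esub>"
proof -
  have "blade (set is) = foldr (\<lambda>i X. generator i \<otimes>\<^bsub>clifford \<eta> n\<^esub> X) is \<one>\<^bsub>clifford \<eta> n\<^esub>"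
    if "sorted_wrt (<) is" "set is \<subseteq> {1..n}" for "is"
    using that
  proof (induction "is")
    case Nil
    then show ?case by (simp add: clifford_simps)
  next
    case (Cons i js)
    have lt: "\<forall>j\<in>set js. i < j" using Cons.prems by simp
    then have "{(a, b). a \<in> {i} \<and> b \<in> set js \<and> b < a} = {}" "{i} \<inter> set js = {}" by auto
    then have "blade_coeff \<eta> {i} (set js) = 1"
      unfolding blade_coeff_def by (simp only: card.empty power_0 prod.empty mult_1)
    moreover have "sym_diff {i} (set js) = set (i # js)" using lt by auto
    ultimately have "generator i \<otimes>\<^bsub>clifford \<eta> n\<^esub> blade (set js) = blade (set (i # js))"
      using Cons.prems by (simp add: blade_mult_blade scale_def)
    then show ?case using Cons by simp
  qed
  from this[of "sorted_list_of_set A"] show ?thesis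
    using assms finite_index[OF assms] by (simp add: strict_sorted_list_of_set)
qed

theorem multivector_expansion:
  assumes "X \<in> carrier (clifford \<eta> n)"
  shows "X = (\<lambda>B. \<Sum>A\<in>Pow {1..n}. scale (X A) (blade A) B)"
proof
  fix B
  have "(\<Sum>A\<in>Pow {1..n}. scale (X A) (blade A) B) = (\<Sum>A\<in>Pow {1..n}. if A = B then X B else 0)"
    by (intro sum.cong) (auto simp: scale_def blade_def)
  then show "X B = (\<Sum>A\<in>Pow {1..n}. scale (X A) (blade A) B)"
    using assms by (auto simp: carrier_clifford_iff)
qed

lemma reversion_sign_add:
  "(-1 :: 'a::field) ^ ((a + b) * (a + b - 1) div 2) =
    (-1) ^ (a * (a - 1) div 2) * (-1) ^ (b * (b - 1) div 2) * (-1) ^ (a * b)"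
proof -
  have "(a + b) choose 2 = (a choose 2) + (b choose 2) + a * b"
    by (induction b) (simp_all add: numeral_2_eq_2)
  then show ?thesis by (simp add: choose_two power_add)
qed

lemma blade_coeff_commute:
  fixes \<eta> :: "nat \<Rightarrow> 'a::field"
  assumes "finite A" "finite B"
  shows "blade_coeff \<eta> A B = (-1) ^ (card A * card B + card (A \<inter> B)) * blade_coeff \<eta> B A"
proof -
  let ?I = "\<lambda>A B. {(a, b). a \<in> A \<and> b \<in> B \<and> b < (a::nat)}"
  let ?D = "(\<lambda>i. (i, i)) ` (A \<inter> B)"
  have sub: "?I A B \<subseteq> A \<times> B" "?I B A \<subseteq> B \<times> A" by auto
  have fin: "finite (?I A B)" "finite (?I B A)"
    using sub assms by (meson finite_SigmaI finite_subset)+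
  have "A \<times> B = ?I A B \<union> (prod.swap ` ?I B A \<union> ?D)"
    by (force simp: image_iff)
  then have "card (A \<times> B) = card (?I A B \<union> (prod.swap ` ?I B A \<union> ?D))" by (rule arg_cong)
  also have "\<dots> = card (?I A B) + card (prod.swap ` ?I B A \<union> ?D)"
    using fin assms by (intro card_Un_disjoint) auto
  also have "card (prod.swap ` ?I B A \<union> ?D) = card (prod.swap ` ?I B A) + card ?D"
    using fin assms by (intro card_Un_disjoint) auto
  also have "card (prod.swap ` ?I B A) = card (?I B A)" by (intro card_image inj_swap)
  also have "card ?D = card (A \<inter> B)" by (intro card_image) (auto simp: inj_on_def)
  finally have "card A * card B = card (?I A B) + (card (?I B A) + card (A \<inter> B))"
    by (simp add: card_cartesian_product)
  then have "(-1 :: 'a) ^ (card A * card B + card (A \<inter> B)) * (-1) ^ card (?I B A) =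
      (-1) ^ (card (?I A B) + 2 * (card (?I B A) + card (A \<inter> B)))"
    by (simp only: power_add[symmetric]) (simp add: mult_2 add_ac)
  then show ?thesis
    unfolding blade_coeff_def by (simp add: power_add power_mult Int_commute mult.assoc[symmetric])
qed

theorem reversion_mult:
  "reversion (X \<otimes>\<^bsub>clifford \<eta> n\<^esub> Y) = reversion Y \<otimes>\<^bsub>clifford \<eta> n\<^esub> reversion X"
proof
  fix C
  let ?r = "\<lambda>k. (-1 :: 'a) ^ (k * (k - 1) div 2)" and ?b = "blade_coeff \<eta>" and ?P = "Pow {1..n}"
  have key: "?r (card (sym_diff A B)) * ?b A B = ?r (card A) * ?r (card B) * ?b B A"
    if AB: "A \<in> ?P" "B \<in> ?P" for A B
  proof -
    have fin: "finite A" "finite B" using AB finite_index by auto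
    define a b c where "a = card A" "b = card B" "c = card (A \<inter> B)"
    define d where "d = card (sym_diff A B)"
    have "d = card (A - B) + card (B - A)"
      unfolding d_def using fin by (intro card_Un_disjoint) auto
    moreover have "card (A - B) + c = a" "card (B - A) + c = b"
      unfolding a_b_c_def using fin
      by (metis card_Int_Diff add.commute, metis card_Int_Diff add.commute Int_commute)
    ultimately have "a + b = d + 2 * c" by simp
    then have "?r (a + b) = ?r d * ?r (2 * c)"
      by (simp only: reversion_sign_add mult.assoc[symmetric])
        (simp add: reversion_sign_add power_mult mult.commute[of d])
    moreover have "?r (2 * c) = (-1) ^ c"
    proof (cases c)
      case (Suc m)
      have "2 * c * (2 * c - 1) div 2 = c + 2 * (c * m)"
        using Suc by (simp add: algebra_simps)
      then show ?thesis by (simp add: power_add power_mult)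
    qed simp
    ultimately have r: "?r a * ?r b * (-1) ^ (a * b) = ?r d * (-1) ^ c"
      by (simp only: reversion_sign_add)
    have one: "(-1 :: 'a) ^ k * (-1) ^ k = 1" for k by (simp add: power_mult_distrib[symmetric])
    have "?r d * ?b A B = ?r d * (-1) ^ c * (-1) ^ (a * b) * ?b B A"
      by (simp add: blade_coeff_commute[OF fin] a_b_c_def power_add mult_ac)
    also have "\<dots> = ?r a * ?r b * ((-1) ^ (a * b) * (-1) ^ (a * b)) * ?b B A"
      by (simp only: r[symmetric] mult.assoc)
    finally show ?thesis unfolding one d_def a_b_c_def by simp
  qed
  have "reversion (X \<otimes>\<^bsub>clifford \<eta> n\<^esub> Y) C = (\<Sum>A\<in>?P. \<Sum>B\<in>?P.
      if sym_diff A B = C then ?r (card (sym_diff A B)) * ?b A B * X A * Y B else 0)"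
    unfolding reversion_def
    by (auto simp: clifford_def sum_distrib_left mult.assoc intro!: sum.cong)
  also have "\<dots> = (\<Sum>A\<in>?P. \<Sum>B\<in>?P.
      if sym_diff B A = C then ?b B A * reversion Y B * reversion X A else 0)"
  proof (intro sum.cong refl)
    fix A B assume AB: "A \<in> ?P" "B \<in> ?P"
    have "sym_diff A B = sym_diff B A" by blast
    then show "(if sym_diff A B = C then ?r (card (sym_diff A B)) * ?b A B * X A * Y B else 0) =
      (if sym_diff B A = C then ?b B A * reversion Y B * reversion X A else 0)"
      unfolding key[OF AB] by (simp add: reversion_def mult_ac)
  qed
  also have "\<dots> = (reversion Y \<otimes>\<^bsub>clifford \<eta> n\<^esub> reversion X) C"
    by (subst sum.swap) (simp add: clifford_def)
  finally show "reversion (X \<otimes>\<^bsub>clifford \<eta> n\<^esub> Y) C = (reversion Y \<otimes>\<^bsub>clifford \<eta> n\<^esub> reversion X) C" .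
qed

theorem grassmann_eq_span:
  "grassmann \<eta> n = {X. \<forall>A. X A \<noteq> 0 \<longrightarrow> A \<subseteq> {i \<in> {1..n}. \<eta> i = 0}}" (is "_ = ?S")
proof
  let ?N = "{i \<in> {1..n}. \<eta> i = 0}"
  show "grassmann \<eta> n \<subseteq> ?S"
  proof
    fix X assume "X \<in> grassmann \<eta> n"
    then show "X \<in> ?S"
    proof induction
      case (add X Y)
      then show ?case unfolding clifford_simps mem_Collect_eq by (metis add.right_neutral)
    next
      case (mult X Y)
      show ?case unfolding mem_Collect_eq
      proof (intro allI impI)
        fix C assume nz: "(X \<otimes>\<^bsub>clifford \<eta> n\<^esub> Y) C \<noteq> 0"
        then have C: "C \<subseteq> {1..n}" using mult_clifford_outside by blast
        have "\<exists>A. X A \<noteq> 0 \<and> Y (sym_diff A C) \<noteq> 0"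
        proof (rule ccontr)
          assume "\<nexists>A. X A \<noteq> 0 \<and> Y (sym_diff A C) \<noteq> 0"
          then have "blade_coeff \<eta> A (sym_diff A C) * X A * Y (sym_diff A C) = 0" for A by simp
          then show False using nz unfolding mult_clifford_nth[OF C] by (simp only: sum.neutral_const not_True_eq_False simp_thms)
        qed
        then obtain A where "X A \<noteq> 0" "Y (sym_diff A C) \<noteq> 0" by blast
        then have "A \<subseteq> ?N" "sym_diff A C \<subseteq> ?N" using mult.IH by blast+
        then show "C \<subseteq> ?N" by blast
      qed
    qed (auto simp: clifford_simps blade_def scale_def split: if_splits)
  qed
  have foldr: "foldr (\<lambda>i X. generator i \<otimes>\<^bsub>clifford \<eta> n\<^esub> X) is \<one>\<^bsub>clifford \<eta> n\<^esub> \<in> grassmann \<eta> n"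
    if "set is \<subseteq> ?N" for "is"
    using that
  proof (induction "is")
    case Nil
    show ?case by (simp add: grassmann.one)
  next
    case (Cons i js)
    have "generator i \<in> grassmann \<eta> n" using Cons.prems by (intro grassmann.generator) auto
    moreover have "foldr (\<lambda>i X. generator i \<otimes>\<^bsub>clifford \<eta> n\<^esub> X) js \<one>\<^bsub>clifford \<eta> n\<^esub> \<in> grassmann \<eta> n"
      using Cons by simp
    ultimately show ?case by (simp add: grassmann.mult)
  qed
  have blade: "blade A \<in> grassmann \<eta> n" if A: "A \<subseteq> ?N" for A
  proof -
    have A': "A \<subseteq> {1..n}" using A by blast
    show ?thesis unfolding blade_eq_ordered_product[OF A', of \<eta>]
      using A finite_index[OF A'] by (intro foldr) simp
  qed
  have sum: "(\<lambda>B. \<Sum>A\<in>F. scale (X A) (blade A) B) \<in> grassmann \<eta> n"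
    if "finite F" "F \<subseteq> Pow ?N" for F X
    using that
  proof (induction F)
    case empty
    have "scale 0 \<one>\<^bsub>clifford \<eta> n\<^esub> \<in> grassmann \<eta> n" by (intro grassmann.intros)
    then show ?case by (simp add: scale_def)
  next
    case (insert A F)
    have "scale (X A) (blade A) \<oplus>\<^bsub>clifford \<eta> n\<^esub> (\<lambda>B. \<Sum>A\<in>F. scale (X A) (blade A) B)
        \<in> grassmann \<eta> n"
      using insert by (intro grassmann.intros blade) auto
    then show ?case using insert by (simp add: clifford_simps)
  qed
  show "?S \<subseteq> grassmann \<eta> n"
  proof
    fix X assume X: "X \<in> ?S"
    have "(\<Sum>A\<in>Pow ?N. scale (X A) (blade A) B) = X B" for B
    proof -
      have "(\<Sum>A\<in>Pow ?N. scale (X A) (blade A) B) = (\<Sum>A\<in>Pow ?N. if A = B then X B else 0)"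
        by (intro sum.cong) (auto simp: scale_def blade_def)
      then show ?thesis using X by auto
    qed
    then show "X \<in> grassmann \<eta> n" using sum[of "Pow ?N" X] by simp
  qed
qed

end

theory Submission
  imports Defs
begin

text \<open>
  The norm of \<open>T\<close> is \<open>W = reversion T \<otimes> T\<close>. Each of the groups consists of the units with
  invertible norm in a subalgebra \<open>H\<close> that is closed under reversion and contains all even
  central elements, in particular the even part of the Grassmann subalgebra.

  The inclusion from right to left is formal: the norm of every left factor \<open>g\<close> lies in \<open>H\<close>, so
  the norm of \<open>g \<otimes> h\<close>, which is \<open>reversion h \<otimes> (reversion g \<otimes> g) \<otimes> h\<close>, does so too
  (\<open>norm_in_subalgebra_mult\<close>).

  For the other inclusion the norm of \<open>T\<close> has to be moved into the even Grassmann
  subalgebra by a factor from \<open>H\<close>. Write \<open>W = W0 + W1\<close>, where \<open>W0\<close> collects the blades of even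
  grade all of whose generators are null. Then \<open>W0\<close> is central. The crucial point is that
  any two blades in \<open>W1\<close>, equal ones included, have anticommutator zero, hence \<open>W1\<close> squares to
  zero. Thus \<open>W0\<close> is invertible and \<open>u = W0\<inverse> W\<close> satisfies \<open>(u - 1)\<^sup>2 = 0\<close>, so the truncated
  binomial series \<open>h = (1 + u) / 2\<close> is an exact square root of \<open>u\<close>. It lies in \<open>H\<close> and is fixed
  by reversion because \<open>W\<close> and \<open>W0\<close> are. The norm of \<open>T \<otimes> h\<inverse>\<close> is therefore
  \<open>h\<inverse> W0 h\<^sup>2 h\<inverse> = W0\<close> (\<open>factor_even_grassmann\<close>).

  That the blades in \<open>W1\<close> anticommute is read off from coordinate descriptions of the
  centralizers. In three of the four cases a blade occurring in \<open>H\<close> either has only null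
  generators or is the product of all generators; degeneracy of the metric makes the latter
  square to zero (\<open>null_or_full_blades_anticommute\<close>). The even part of the centralizer of grade
  3 can contain further blades, such as \<open>e\<^sub>1 e\<^sub>2\<close> for \<open>n \<le> 3\<close>, which need not be nilpotent; but \<open>W\<close>
  is fixed by reversion, so its even blades have grades divisible by 4, and in these grades two
  blades with a non-null generator always share a null generator
  (\<open>even_centralizer_3_blades_share_null\<close>).
\<close>

section \<open>Commutation of basis blades\<close>

lemma blade_coeff_eq_0_iff:
  "finite (A \<inter> B) \<Longrightarrow> blade_coeff \<eta> A B = 0 \<longleftrightarrow> (\<exists>i\<in>A \<inter> B. \<eta> i = 0)"
  by (simp add: blade_coeff_def)

text \<open>
  The sign \<open>(-1)\<^sup>k\<close> serves three purposes: \<open>k = 0\<close> expresses commutation, \<open>k = 1\<close> anticommutation,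
  and the grade of \<open>A\<close> gives the twisted commutation with the grade involution. A common null
  generator makes both products zero.
\<close>

lemma blade_coeff_commute_sign_iff:
  fixes \<eta> :: "nat \<Rightarrow> 'a::field_char_0"
  assumes "finite A" "finite B"
  shows "(-1) ^ k * blade_coeff \<eta> A B = blade_coeff \<eta> B A \<longleftrightarrow>
    (\<exists>i\<in>A \<inter> B. \<eta> i = 0) \<or> even (k + card A * card B + card (A \<inter> B))"
proof -
  let ?e = "k + card A * card B + card (A \<inter> B)"
  have swap: "(-1) ^ k * blade_coeff \<eta> A B = (-1) ^ ?e * blade_coeff \<eta> B A"
    by (simp add: blade_coeff_commute[OF assms] power_add)
  have zero: "blade_coeff \<eta> B A = 0 \<longleftrightarrow> (\<exists>i\<in>A \<inter> B. \<eta> i = 0)"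
    using blade_coeff_eq_0_iff[of B A \<eta>] assms by (auto simp: Int_commute)
  show ?thesis
    unfolding swap zero[symmetric] by (cases "even ?e") (auto simp: minus_one_power_iff)
qed

lemma even_card_sym_diff_iff:
  assumes "finite A" "finite B"
  shows "even (card (sym_diff A B)) \<longleftrightarrow> even (card A + card B)"
proof -
  have "card (sym_diff A B) = card (A - B) + card (B - A)"
    using assms by (intro card_Un_disjoint) auto
  moreover have "card A = card (A - B) + card (A \<inter> B)" "card B = card (B - A) + card (A \<inter> B)"
    using assms by (metis card_Int_Diff add.commute, metis card_Int_Diff add.commute Int_commute)
  ultimately show ?thesis by (simp only: even_add) blast
qed

context
  fixes \<eta> :: "nat \<Rightarrow> 'a::field_char_0" and n :: nat
begin

abbreviation (input) clifford_mult (infixl "\<odot>" 70) where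
  "X \<odot> Y \<equiv> X \<otimes>\<^bsub>clifford \<eta> n\<^esub> Y"

interpretation clifford: ring "clifford \<eta> n"
  by (rule ring_clifford)

text \<open>
  For fixed \<open>B\<close> the map from \<open>A\<close> to the symmetric difference of \<open>A\<close> and \<open>B\<close> is injective, so
  distinct blades of \<open>X\<close> never mix when \<open>X\<close> is multiplied by a blade. This is why commutation
  with a grade subspace can be tested blade by blade.
\<close>

lemma mult_blade_nth:
  assumes "A \<subseteq> {1..n}" "B \<subseteq> {1..n}"
  shows "(X \<odot> blade B) (sym_diff A B) = blade_coeff \<eta> A B * X A"
    and "(blade B \<odot> X) (sym_diff A B) = blade_coeff \<eta> B A * X A"
proof -
  let ?C = "sym_diff A B"
  have C: "?C \<subseteq> {1..n}" using assms by blast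
  have eq: "sym_diff A' ?C = B \<longleftrightarrow> A' = A" for A' by blast
  have e: "sym_diff A ?C = B" "sym_diff B ?C = A" by blast+
  have "(X \<odot> blade B) ?C = (\<Sum>A'\<in>Pow {1..n}. if A' = A then blade_coeff \<eta> A B * X A else 0)"
    unfolding mult_clifford_nth[OF C] by (intro sum.cong refl) (auto simp: blade_def eq e)
  then show "(X \<odot> blade B) ?C = blade_coeff \<eta> A B * X A" using assms by simp
  have "(blade B \<odot> X) ?C = (\<Sum>A'\<in>Pow {1..n}. if A' = B then blade_coeff \<eta> B A * X A else 0)"
    unfolding mult_clifford_nth[OF C] by (intro sum.cong refl) (auto simp: blade_def e)
  then show "(blade B \<odot> X) ?C = blade_coeff \<eta> B A * X A" using assms by simp
qed

lemma mult_eq_of_blades: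
  assumes "\<And>A B. A \<subseteq> {1..n} \<Longrightarrow> B \<subseteq> {1..n} \<Longrightarrow> X A \<noteq> 0 \<Longrightarrow> V B \<noteq> 0 \<Longrightarrow>
    s A * blade_coeff \<eta> A B = blade_coeff \<eta> B A"
  shows "(\<lambda>A. s A * X A) \<odot> V = V \<odot> X"
proof
  fix C
  let ?P = "Pow {1..n}"
  have "((\<lambda>A. s A * X A) \<odot> V) C = (\<Sum>A\<in>?P. \<Sum>B\<in>?P.
      if sym_diff A B = C then blade_coeff \<eta> A B * (s A * X A) * V B else 0)"
    by (simp add: clifford_def)
  also have "\<dots> = (\<Sum>A\<in>?P. \<Sum>B\<in>?P.
      if sym_diff B A = C then blade_coeff \<eta> B A * V B * X A else 0)"
  proof (intro sum.cong refl)
    fix A B assume AB: "A \<in> ?P" "B \<in> ?P"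
    have "sym_diff A B = sym_diff B A" by blast
    moreover have "blade_coeff \<eta> A B * (s A * X A) * V B = blade_coeff \<eta> B A * V B * X A"
    proof (cases "X A = 0 \<or> V B = 0")
      case False
      then have "blade_coeff \<eta> B A = s A * blade_coeff \<eta> A B" using assms[of A B] AB by simp
      then show ?thesis by (simp add: mult_ac)
    qed auto
    ultimately show "(if sym_diff A B = C then blade_coeff \<eta> A B * (s A * X A) * V B else 0) =
        (if sym_diff B A = C then blade_coeff \<eta> B A * V B * X A else 0)" by simp
  qed
  also have "\<dots> = (V \<odot> X) C"
    by (subst sum.swap) (simp add: clifford_def)
  finally show "((\<lambda>A. s A * X A) \<odot> V) C = (V \<odot> X) C" .
qed

lemma intertwines_grade_iff:
  assumes X: "X \<in> carrier (clifford \<eta> n)"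
  shows "(\<forall>V\<in>grade_subspace \<eta> n m. (\<lambda>A. (-1) ^ k A * X A) \<odot> V = V \<odot> X) \<longleftrightarrow>
    (\<forall>A. X A \<noteq> 0 \<longrightarrow> (\<forall>B. B \<subseteq> {1..n} \<longrightarrow> card B = m \<longrightarrow>
      (\<exists>i\<in>A \<inter> B. \<eta> i = 0) \<or> even (k A + card A * m + card (A \<inter> B))))" (is "?L \<longleftrightarrow> ?R")
proof
  assume L: ?L
  show ?R
  proof (intro allI impI)
    fix A B assume A: "X A \<noteq> 0" and B: "B \<subseteq> {1..n}" "card B = m"
    have A': "A \<subseteq> {1..n}" using X A by (simp add: carrier_clifford_iff)
    have "blade B \<in> grade_subspace \<eta> n m"
      using B by (auto simp: grade_subspace_def blade_def carrier_clifford_iff)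
    then have "(\<lambda>A. (-1) ^ k A * X A) \<odot> blade B = blade B \<odot> X" using L by blast
    then have "blade_coeff \<eta> A B * ((-1) ^ k A * X A) = blade_coeff \<eta> B A * X A"
      using mult_blade_nth[OF A' B(1)] by metis
    then have "(-1) ^ k A * blade_coeff \<eta> A B = blade_coeff \<eta> B A"
      using A by (simp add: mult_ac)
    then show "(\<exists>i\<in>A \<inter> B. \<eta> i = 0) \<or> even (k A + card A * m + card (A \<inter> B))"
      using blade_coeff_commute_sign_iff[of A B "k A" \<eta>] A' B finite_index by auto
  qed
next
  assume R: ?R
  show ?L
  proof
    fix V :: "'a multivector" assume V: "V \<in> grade_subspace \<eta> n m"
    show "(\<lambda>A. (-1) ^ k A * X A) \<odot> V = V \<odot> X"
    proof (rule mult_eq_of_blades)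
      fix A B assume AB: "A \<subseteq> {1..n}" "B \<subseteq> {1..n}" "X A \<noteq> 0" "V B \<noteq> 0"
      then have "card B = m" using V by (simp add: grade_subspace_def)
      then show "(-1) ^ k A * blade_coeff \<eta> A B = blade_coeff \<eta> B A"
        using R AB blade_coeff_commute_sign_iff[of A B "k A" \<eta>] finite_index by auto
    qed
  qed
qed

lemma centralizer_iff:
  "X \<in> centralizer \<eta> n m \<longleftrightarrow> X \<in> carrier (clifford \<eta> n) \<and>
    (\<forall>A. X A \<noteq> 0 \<longrightarrow> (\<forall>B. B \<subseteq> {1..n} \<longrightarrow> card B = m \<longrightarrow>
      (\<exists>i\<in>A \<inter> B. \<eta> i = 0) \<or> even (card A * m + card (A \<inter> B))))"
  using intertwines_grade_iff[of X m "\<lambda>_. 0"] unfolding centralizer_def by auto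

lemma twisted_centralizer_iff:
  "X \<in> twisted_centralizer \<eta> n m \<longleftrightarrow> X \<in> carrier (clifford \<eta> n) \<and>
    (\<forall>A. X A \<noteq> 0 \<longrightarrow> (\<forall>B. B \<subseteq> {1..n} \<longrightarrow> card B = m \<longrightarrow>
      (\<exists>i\<in>A \<inter> B. \<eta> i = 0) \<or> even (card A + card A * m + card (A \<inter> B))))"
  using intertwines_grade_iff[of X m card]
  unfolding twisted_centralizer_def grade_involution_def by auto

lemma even_grassmann_iff:
  "X \<in> even_grassmann \<eta> n \<longleftrightarrow>
    (\<forall>A. X A \<noteq> 0 \<longrightarrow> A \<subseteq> {1..n} \<and> (\<forall>i\<in>A. \<eta> i = 0) \<and> even (card A))"
proof -
  have "A \<subseteq> {i \<in> {1..n}. \<eta> i = 0} \<longleftrightarrow> A \<subseteq> {1..n} \<and> (\<forall>i\<in>A. \<eta> i = 0)" for A by blast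
  then show ?thesis
    unfolding even_grassmann_def grassmann_eq_span even_subspace_def
    by (simp only: Int_iff mem_Collect_eq carrier_clifford_iff) meson
qed

section \<open>Parity and reversion\<close>

lemma grade_involution_mult:
  "grade_involution (X \<odot> Y) = grade_involution X \<odot> grade_involution Y"
proof
  fix C
  let ?P = "Pow {1..n}"
  have sign: "(-1 :: 'a) ^ card (sym_diff A B) = (-1) ^ card A * (-1) ^ card B"
    if "A \<in> ?P" "B \<in> ?P" for A B
    using that finite_index even_card_sym_diff_iff[of A B]
    by (auto simp: power_add[symmetric] minus_one_power_iff)
  have "grade_involution (X \<odot> Y) C = (\<Sum>A\<in>?P. \<Sum>B\<in>?P.
      if sym_diff A B = C then (-1) ^ card (sym_diff A B) * (blade_coeff \<eta> A B * X A * Y B) else 0)"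
    unfolding grade_involution_def clifford_def monoid.simps sum_distrib_left
    by (intro sum.cong refl) simp
  also have "\<dots> = (\<Sum>A\<in>?P. \<Sum>B\<in>?P. if sym_diff A B = C
      then blade_coeff \<eta> A B * grade_involution X A * grade_involution Y B else 0)"
    by (intro sum.cong refl) (simp only: sign, simp add: grade_involution_def mult_ac)
  also have "\<dots> = (grade_involution X \<odot> grade_involution Y) C" by (simp add: clifford_def)
  finally show "grade_involution (X \<odot> Y) C = (grade_involution X \<odot> grade_involution Y) C" .
qed

lemma grade_involution_one: "grade_involution \<one>\<^bsub>clifford \<eta> n\<^esub> = \<one>\<^bsub>clifford \<eta> n\<^esub>"
  by (auto simp: grade_involution_def clifford_simps blade_def)

lemma grade_involution_closed:
  "X \<in> carrier (clifford \<eta> n) \<Longrightarrow> grade_involution X \<in> carrier (clifford \<eta> n)"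
  by (auto simp: grade_involution_def carrier_clifford_iff)

lemma even_subspace_iff:
  "X \<in> even_subspace \<eta> n \<longleftrightarrow> X \<in> carrier (clifford \<eta> n) \<and> grade_involution X = X"
proof -
  have "(-1) ^ card A * X A = X A \<longleftrightarrow> (X A \<noteq> 0 \<longrightarrow> even (card A))" for A
    by (auto simp: minus_one_power_iff)
  then show ?thesis by (simp add: even_subspace_def grade_involution_def fun_eq_iff)
qed

lemma reversion_one: "reversion \<one>\<^bsub>clifford \<eta> n\<^esub> = \<one>\<^bsub>clifford \<eta> n\<^esub>"
  by (auto simp: reversion_def clifford_simps blade_def)

lemma reversion_closed:
  "X \<in> carrier (clifford \<eta> n) \<Longrightarrow> reversion X \<in> carrier (clifford \<eta> n)"
  by (auto simp: reversion_def carrier_clifford_iff)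

lemma reversion_reversion: "reversion (reversion X) = (X :: 'a multivector)"
  by (simp add: reversion_def mult.assoc[symmetric] power_mult_distrib[symmetric])

lemma reversion_eq_0_iff: "reversion X A = 0 \<longleftrightarrow> X A = (0 :: 'a)"
  by (simp add: reversion_def)

lemma reversion_Units:
  assumes "T \<in> Units (clifford \<eta> n)"
  shows "reversion T \<in> Units (clifford \<eta> n)"
proof -
  let ?I = "inv\<^bsub>clifford \<eta> n\<^esub> T"
  have "reversion T \<odot> reversion ?I = \<one>\<^bsub>clifford \<eta> n\<^esub>" "reversion ?I \<odot> reversion T = \<one>\<^bsub>clifford \<eta> n\<^esub>"
    using assms by (simp_all only: reversion_mult[symmetric] clifford.Units_l_inv
        clifford.Units_r_inv reversion_one)
  moreover have "reversion T \<in> carrier (clifford \<eta> n)" "reversion ?I \<in> carrier (clifford \<eta> n)"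
    using clifford.Units_closed[OF assms] clifford.Units_inv_closed[OF assms]
    by (blast intro: reversion_closed)+
  ultimately show ?thesis unfolding Units_def by blast
qed

text \<open>The sign \<open>(-1) ^ (k * (k - 1) div 2)\<close> is negative exactly for \<open>k \<equiv> 2, 3\<close> modulo 4.\<close>

lemma grade_of_reversion_fixed:
  assumes "reversion X = X" "X A \<noteq> (0 :: 'a)"
  shows "card A mod 4 = 0 \<or> card A mod 4 = 1"
proof -
  have "(-1 :: 'a) ^ (card A * (card A - 1) div 2) * X A = X A"
    using fun_cong[OF assms(1), of A] unfolding reversion_def .
  then have ev: "even (card A * (card A - 1) div 2)"
    using assms(2) by (auto simp: minus_one_power_iff split: if_splits)
  obtain q m where q: "card A = 4 * q + m" "m < 4"
    by (rule that[of "card A div 4" "card A mod 4"]) simp_all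
  show ?thesis
  proof (rule ccontr)
    assume "\<not> ?thesis"
    then have "m = 2 \<or> m = 3" using q by auto
    then have "card A * (card A - 1) = 2 * (2 * (4 * q * q + 3 * q) + 1) \<or>
        card A * (card A - 1) = 2 * (2 * (4 * q * q + 5 * q + 1) + 1)"
    proof
      assume "m = 2"
      then have "card A = 4 * q + 2" "card A - 1 = 4 * q + 1" using q(1) by simp_all
      then show ?thesis by (simp add: algebra_simps)
    next
      assume "m = 3"
      then have "card A = 4 * q + 3" "card A - 1 = 4 * q + 2" using q(1) by simp_all
      then show ?thesis by (simp add: algebra_simps)
    qed
    then have "odd (card A * (card A - 1) div 2)" by auto
    then show False using ev by simp
  qed
qed


section \<open>Squares of sums of anticommuting blades\<close>

text \<open>
  Each pair \<open>A, B\<close> contributes \<open>X A * X B\<close> times the anticommutator of the two blades to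
  \<open>2 X\<^sup>2\<close>. Pairs with \<open>A = B\<close> are included, for which the parity in the hypothesis is even:
  such a blade has to contain a null generator.
\<close>

lemma square_eq_zero:
  assumes "\<And>A B. A \<subseteq> {1..n} \<Longrightarrow> B \<subseteq> {1..n} \<Longrightarrow> X A \<noteq> 0 \<Longrightarrow> X B \<noteq> 0 \<Longrightarrow>
    (\<exists>i\<in>A \<inter> B. \<eta> i = 0) \<or> odd (card A * card B + card (A \<inter> B))"
  shows "X \<odot> X = \<zero>\<^bsub>clifford \<eta> n\<^esub>"
proof -
  have "(\<lambda>A. - 1 * X A) \<odot> X = X \<odot> X"
  proof (rule mult_eq_of_blades)
    fix A B assume AB: "A \<subseteq> {1..n}" "B \<subseteq> {1..n}" "X A \<noteq> 0" "X B \<noteq> 0"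
    then have "finite A" "finite B" using finite_index by auto
    from blade_coeff_commute_sign_iff[OF this, of 1 \<eta>]
    show "- 1 * blade_coeff \<eta> A B = blade_coeff \<eta> B A" using assms[OF AB] by simp
  qed
  then have "scale (- 1) (X \<odot> X) = X \<odot> X"
    unfolding scale_mult_clifford(1)[symmetric] scale_def[of "- 1" X] .
  then have "- (X \<odot> X) C = (X \<odot> X) C" for C
    unfolding scale_def by (metis mult_minus1)
  then have "2 * (X \<odot> X) C = 0" for C
    by (metis add.right_inverse mult_2)
  then show ?thesis by (simp add: clifford_simps fun_eq_iff)
qed

text \<open>
  Blades with a common null generator multiply to zero in either order, and disjoint blades
  commute as soon as one of them has even grade.
\<close>

lemma even_grassmann_subset_center: "even_grassmann \<eta> n \<subseteq> center \<eta> n \<inter> even_subspace \<eta> n"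
proof
  fix X assume "X \<in> even_grassmann \<eta> n"
  then have X: "A \<subseteq> {1..n} \<and> (\<forall>i\<in>A. \<eta> i = 0) \<and> even (card A)" if "X A \<noteq> 0" for A
    using that unfolding even_grassmann_iff by blast
  have "(\<lambda>A. 1 * X A) \<odot> V = V \<odot> X" for V
  proof (rule mult_eq_of_blades)
    fix A B assume AB: "A \<subseteq> {1..n}" "B \<subseteq> {1..n}" "X A \<noteq> 0"
    then have "finite A" "finite B" using finite_index by auto
    from blade_coeff_commute_sign_iff[OF this, of 0 \<eta>]
    show "1 * blade_coeff \<eta> A B = blade_coeff \<eta> B A"
      using X[OF AB(3)] by (cases "A \<inter> B = {}") auto
  qed
  then show "X \<in> center \<eta> n \<inter> even_subspace \<eta> n"
    using X by (auto simp: center_def even_subspace_def carrier_clifford_iff)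
qed

section \<open>Subalgebras closed under reversion\<close>

text \<open>
  Asking for the even central elements, and not only for the unit, makes every such set
  contain \<open>W0\<inverse>\<close> for each invertible even Grassmann element \<open>W0\<close>, with no analysis of inverses
  within the subalgebra.
\<close>

definition reversible_subalgebra :: "'a multivector set \<Rightarrow> bool" where
  "reversible_subalgebra H \<longleftrightarrow>
    H \<subseteq> carrier (clifford \<eta> n) \<and> center \<eta> n \<inter> even_subspace \<eta> n \<subseteq> H \<and>
    (\<forall>X\<in>H. \<forall>Y\<in>H. X \<odot> Y \<in> H \<and> X \<oplus>\<^bsub>clifford \<eta> n\<^esub> Y \<in> H) \<and>
    (\<forall>X\<in>H. \<forall>c. scale c X \<in> H) \<and> (\<forall>X\<in>H. reversion X \<in> H)"

text \<open>
  For a subspace spanned by blades all closure properties but the one under products are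
  immediate, since they concern only which coordinates vanish.
\<close>

lemma reversible_subalgebraI:
  assumes span: "\<And>X. X \<in> H \<longleftrightarrow> X \<in> carrier (clifford \<eta> n) \<and> (\<forall>A. X A \<noteq> 0 \<longrightarrow> P A)"
    and "center \<eta> n \<inter> even_subspace \<eta> n \<subseteq> H"
    and "\<And>X Y. X \<in> H \<Longrightarrow> Y \<in> H \<Longrightarrow> X \<odot> Y \<in> H"
  shows "reversible_subalgebra H"
  unfolding reversible_subalgebra_def
proof (intro conjI ballI allI)
  show "H \<subseteq> carrier (clifford \<eta> n)" using span by blast
next
  fix X Y assume XY: "X \<in> H" "Y \<in> H"
  then have "P A" if "X A + Y A \<noteq> 0" for A using that span by (metis add.right_neutral)
  then show "X \<oplus>\<^bsub>clifford \<eta> n\<^esub> Y \<in> H"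
    using XY clifford.a_closed[of X Y] unfolding span by (simp add: clifford_simps)
next
  fix X c assume "X \<in> H"
  then show "scale c X \<in> H" unfolding span carrier_clifford_iff scale_def by simp
next
  fix X assume "X \<in> H"
  then show "reversion X \<in> H" unfolding span by (simp add: reversion_closed reversion_eq_0_iff)
qed (fact assms(2), (rule assms(3); assumption))

lemma reversible_subalgebra_Int:
  "reversible_subalgebra H \<Longrightarrow> reversible_subalgebra K \<Longrightarrow> reversible_subalgebra (H \<inter> K)"
  unfolding reversible_subalgebra_def by blast

lemma reversible_subalgebra_centralizer: "reversible_subalgebra (centralizer \<eta> n m)"
proof (rule reversible_subalgebraI[OF centralizer_iff])
  show "center \<eta> n \<inter> even_subspace \<eta> n \<subseteq> centralizer \<eta> n m"
    by (auto simp: center_def centralizer_def grade_subspace_def)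
next
  fix X Y assume XY: "X \<in> centralizer \<eta> n m" "Y \<in> centralizer \<eta> n m"
  show "X \<odot> Y \<in> centralizer \<eta> n m"
    unfolding centralizer_def
  proof (intro CollectI conjI ballI mult_clifford_closed)
    fix V :: "'a multivector" assume "V \<in> grade_subspace \<eta> n m"
    then have V: "X \<odot> V = V \<odot> X" "Y \<odot> V = V \<odot> Y" using XY unfolding centralizer_def by blast+
    show "(X \<odot> Y) \<odot> V = V \<odot> (X \<odot> Y)"
      by (metis V mult_clifford_assoc)
  qed
qed

lemma reversible_subalgebra_twisted_centralizer:
  "reversible_subalgebra (twisted_centralizer \<eta> n m)"
proof (rule reversible_subalgebraI[OF twisted_centralizer_iff])
  show "center \<eta> n \<inter> even_subspace \<eta> n \<subseteq> twisted_centralizer \<eta> n m"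
    by (auto simp: center_def twisted_centralizer_def grade_subspace_def even_subspace_iff)
next
  fix X Y assume XY: "X \<in> twisted_centralizer \<eta> n m" "Y \<in> twisted_centralizer \<eta> n m"
  show "X \<odot> Y \<in> twisted_centralizer \<eta> n m"
    unfolding twisted_centralizer_def
  proof (intro CollectI conjI ballI mult_clifford_closed)
    fix V :: "'a multivector" assume "V \<in> grade_subspace \<eta> n m"
    then have V: "grade_involution X \<odot> V = V \<odot> X" "grade_involution Y \<odot> V = V \<odot> Y"
      using XY unfolding twisted_centralizer_def by blast+
    show "grade_involution (X \<odot> Y) \<odot> V = V \<odot> (X \<odot> Y)"
      unfolding grade_involution_mult by (metis V mult_clifford_assoc)
  qed
qed

lemma reversible_subalgebra_even: "reversible_subalgebra (even_subspace \<eta> n)"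
proof (rule reversible_subalgebraI)
  show "X \<in> even_subspace \<eta> n \<longleftrightarrow>
      X \<in> carrier (clifford \<eta> n) \<and> (\<forall>A. X A \<noteq> 0 \<longrightarrow> even (card A))" for X
    by (simp add: even_subspace_def)
qed (auto simp: even_subspace_iff mult_clifford_closed grade_involution_mult)

section \<open>Extracting a square root\<close>

text \<open>
  The square root \<open>h = (1 + W0\<inverse> W) / 2\<close> of \<open>W0\<inverse> W\<close> is the right factor: dividing \<open>T\<close> by \<open>h\<close> leaves
  an element with norm \<open>W0\<close>. The hypothesis \<open>anticommute\<close> makes \<open>W - W0\<close> square to zero.
\<close>

lemma factor_even_grassmann:
  assumes H: "reversible_subalgebra H"
    and T: "T \<in> Units (clifford \<eta> n)" and WH: "reversion T \<odot> T \<in> H"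
    and anticommute: "\<And>A B. A \<subseteq> {1..n} \<Longrightarrow> B \<subseteq> {1..n} \<Longrightarrow>
      (reversion T \<odot> T) A \<noteq> 0 \<Longrightarrow> (reversion T \<odot> T) B \<noteq> 0 \<Longrightarrow>
      \<not> ((\<forall>i\<in>A. \<eta> i = 0) \<and> even (card A)) \<Longrightarrow> \<not> ((\<forall>i\<in>B. \<eta> i = 0) \<and> even (card B)) \<Longrightarrow>
      (\<exists>i\<in>A \<inter> B. \<eta> i = 0) \<or> odd (card A * card B + card (A \<inter> B))"
  shows "T \<in> group_check_A \<eta> n <#>\<^bsub>clifford \<eta> n\<^esub> invertibles \<eta> n H"
proof -
  let ?R = "clifford \<eta> n"
  let ?C = "carrier ?R"
  define W where "W = reversion T \<odot> T"
  define W0 where "W0 = (\<lambda>A. if (\<forall>i\<in>A. \<eta> i = 0) \<and> even (card A) then W A else 0)"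
  define W1 where "W1 = (\<lambda>A. if (\<forall>i\<in>A. \<eta> i = 0) \<and> even (card A) then 0 else W A)"
  have WU: "W \<in> Units ?R" unfolding W_def using T by (simp add: reversion_Units)
  then have WC: "W \<in> ?C" by (rule clifford.Units_closed)
  have Wrev: "reversion W = W" unfolding W_def by (simp add: reversion_mult reversion_reversion)
  have W0C: "W0 \<in> ?C" and W1C: "W1 \<in> ?C"
    using WC by (auto simp: W0_def W1_def carrier_clifford_iff)
  have W0rev: "reversion W0 = W0"
  proof
    fix A
    show "reversion W0 A = W0 A" using fun_cong[OF Wrev, of A] by (simp add: W0_def reversion_def)
  qed
  have split: "W = W0 \<oplus>\<^bsub>?R\<^esub> W1" by (auto simp: W0_def W1_def clifford_simps)
  have W0G: "W0 \<in> even_grassmann \<eta> n"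
    unfolding even_grassmann_iff using WC by (auto simp: W0_def carrier_clifford_iff split: if_splits)
  then have W0even: "grade_involution W0 = W0"
    using even_grassmann_subset_center even_subspace_iff by blast
  have comm: "W0 \<odot> X = X \<odot> W0" if "X \<in> ?C" for X
    using W0G even_grassmann_subset_center that unfolding center_def by blast
  have nil: "W1 \<odot> W1 = \<zero>\<^bsub>?R\<^esub>"
  proof (rule square_eq_zero)
    fix A B assume "A \<subseteq> {1..n}" "B \<subseteq> {1..n}" "W1 A \<noteq> 0" "W1 B \<noteq> 0"
    then show "(\<exists>i\<in>A \<inter> B. \<eta> i = 0) \<or> odd (card A * card B + card (A \<inter> B))"
      by (intro anticommute) (auto simp: W1_def W_def split: if_splits)
  qed
  have "W \<odot> W = W0 \<odot> W \<oplus>\<^bsub>?R\<^esub> W1 \<odot> W"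
    using split clifford.l_distr[OF W0C W1C WC] by simp
  also have "W1 \<odot> W = W1 \<odot> W0 \<oplus>\<^bsub>?R\<^esub> W1 \<odot> W1"
    using split clifford.r_distr[OF W0C W1C W1C] by simp
  also have "\<dots> = W0 \<odot> W1" using W0C W1C comm[OF W1C] nil by simp
  finally have sq: "W \<odot> W = W0 \<odot> W \<oplus>\<^bsub>?R\<^esub> W0 \<odot> W1" .
  have "W0 \<odot> W = W0 \<odot> W0 \<oplus>\<^bsub>?R\<^esub> W0 \<odot> W1"
    using split clifford.r_distr[OF W0C W1C W0C] by simp
  then have quad: "W \<odot> W \<oplus>\<^bsub>?R\<^esub> W0 \<odot> W0 = W0 \<odot> W \<oplus>\<^bsub>?R\<^esub> W0 \<odot> W"
    using sq WC W0C W1C by (simp add: clifford.a_ac)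
  \<comment> \<open>\<open>sq\<close> says \<open>W\<^sup>2 = W0 (W + W1)\<close>, so \<open>W0\<close> divides the unit \<open>W\<^sup>2\<close>; since \<open>W0\<close> is central, a one-sided inverse suffices.\<close>
  have W0U: "W0 \<in> Units ?R"
  proof -
    define Y where "Y = (W \<oplus>\<^bsub>?R\<^esub> W1) \<odot> inv\<^bsub>?R\<^esub> (W \<odot> W)"
    have Y: "Y \<in> ?C" unfolding Y_def by (rule mult_clifford_closed)
    have "W0 \<odot> Y = (W \<odot> W) \<odot> inv\<^bsub>?R\<^esub> (W \<odot> W)"
      unfolding Y_def mult_clifford_assoc[symmetric] sq
      using clifford.r_distr[OF WC W1C W0C] by simp
    also have "\<dots> = \<one>\<^bsub>?R\<^esub>" using WU by simp
    finally have "W0 \<odot> Y = \<one>\<^bsub>?R\<^esub>" .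
    then show ?thesis using comm[OF Y] W0C Y unfolding Units_def by auto
  qed
  define V where "V = inv\<^bsub>?R\<^esub> W0"
  have VU: "V \<in> Units ?R" and VC: "V \<in> ?C" unfolding V_def using W0U by (simp_all add: clifford.Units_inv_closed clifford.Units_inv_Units)
  have VW0: "V \<odot> W0 = \<one>\<^bsub>?R\<^esub>" "W0 \<odot> V = \<one>\<^bsub>?R\<^esub>" unfolding V_def using W0U by simp_all
  have Vcomm: "V \<odot> X = X \<odot> V" if X: "X \<in> ?C" for X
  proof -
    have "V \<odot> X = V \<odot> (X \<odot> (W0 \<odot> V))" using X VW0 by simp
    also have "\<dots> = V \<odot> (W0 \<odot> (X \<odot> V))" by (metis comm[OF X] mult_clifford_assoc)
    also have "\<dots> = X \<odot> V"
      by (metis VW0(1) clifford.l_one mult_clifford_assoc mult_clifford_closed)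
    finally show ?thesis .
  qed
  have Veven: "grade_involution V = V"
  proof (rule clifford.inv_unique[OF _ VW0(2) W0C grade_involution_closed[OF VC] VC])
    show "grade_involution V \<odot> W0 = \<one>\<^bsub>?R\<^esub>"
      using grade_involution_mult[of V W0] VW0 grade_involution_one W0even by simp
  qed
  have Vrev: "reversion V = V"
  proof (rule clifford.inv_unique[OF _ VW0(2) W0C reversion_closed[OF VC] VC])
    show "reversion V \<odot> W0 = \<one>\<^bsub>?R\<^esub>"
      using reversion_mult[where X = W0 and Y = V and \<eta> = \<eta> and n = n] VW0 reversion_one W0rev by simp
  qed
  have VH: "V \<in> H"
  proof -
    have "V \<in> center \<eta> n \<inter> even_subspace \<eta> n"
      using VC Vcomm Veven by (simp add: center_def even_subspace_iff)
    then show ?thesis using H unfolding reversible_subalgebra_def by blast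
  qed
  define u where "u = V \<odot> W"
  have uC: "u \<in> ?C" and uU: "u \<in> Units ?R" unfolding u_def using VU WU by (simp_all add: mult_clifford_closed)
  have urev: "reversion u = u"
    unfolding u_def reversion_mult Wrev Vrev using Vcomm[OF WC] by simp
  have W_eq: "W = W0 \<odot> u"
    unfolding u_def using WC VW0 by (metis clifford.l_one mult_clifford_assoc)
  \<comment> \<open>This is \<open>(u - 1)\<^sup>2 = 0\<close>: the equation \<open>quad\<close>, that is \<open>(W - W0)\<^sup>2 = 0\<close>, divided by \<open>W0\<^sup>2\<close>.\<close>
  have uu: "u \<odot> u \<oplus>\<^bsub>?R\<^esub> \<one>\<^bsub>?R\<^esub> = u \<oplus>\<^bsub>?R\<^esub> u"
  proof -
    have 1: "u \<odot> u = (V \<odot> V) \<odot> (W \<odot> W)"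
      unfolding u_def by (metis Vcomm[OF WC] mult_clifford_assoc)
    have 2: "\<one>\<^bsub>?R\<^esub> = (V \<odot> V) \<odot> (W0 \<odot> W0)"
      using VW0 VC W0C by (metis clifford.r_one mult_clifford_assoc)
    have 3: "u = (V \<odot> V) \<odot> (W0 \<odot> W)"
      unfolding u_def using VW0 VC by (metis clifford.r_one mult_clifford_assoc)
    have "u \<odot> u \<oplus>\<^bsub>?R\<^esub> \<one>\<^bsub>?R\<^esub> = (V \<odot> V) \<odot> (W \<odot> W \<oplus>\<^bsub>?R\<^esub> W0 \<odot> W0)"
      unfolding 1 by (subst 2) (simp add: clifford.r_distr mult_clifford_closed)
    also have "\<dots> = u \<oplus>\<^bsub>?R\<^esub> u"
      unfolding quad by (subst (1 2) 3) (simp add: clifford.r_distr mult_clifford_closed)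
    finally show ?thesis .
  qed
  define h where "h = scale (1 / 2) (\<one>\<^bsub>?R\<^esub> \<oplus>\<^bsub>?R\<^esub> u)"
  have hC: "h \<in> ?C" unfolding h_def using clifford.a_closed[OF clifford.one_closed uC]
    by (simp add: carrier_clifford_iff scale_def)
  have hh: "h \<odot> h = u"
  proof
    fix A
    have "(\<one>\<^bsub>?R\<^esub> \<oplus>\<^bsub>?R\<^esub> u) \<odot> (\<one>\<^bsub>?R\<^esub> \<oplus>\<^bsub>?R\<^esub> u) = u \<oplus>\<^bsub>?R\<^esub> u \<oplus>\<^bsub>?R\<^esub> (u \<odot> u \<oplus>\<^bsub>?R\<^esub> \<one>\<^bsub>?R\<^esub>)"
      using uC by (simp add: clifford.l_distr clifford.r_distr clifford.a_ac mult_clifford_closed)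
    then have "((\<one>\<^bsub>?R\<^esub> \<oplus>\<^bsub>?R\<^esub> u) \<odot> (\<one>\<^bsub>?R\<^esub> \<oplus>\<^bsub>?R\<^esub> u)) A = 4 * u A"
      unfolding uu by (simp add: clifford_simps)
    then show "(h \<odot> h) A = u A"
      unfolding h_def scale_mult_clifford by (simp add: scale_def)
  qed
  have hU: "h \<in> Units ?R"
  proof -
    have r: "h \<odot> (h \<odot> inv\<^bsub>?R\<^esub> u) = \<one>\<^bsub>?R\<^esub>"
      unfolding mult_clifford_assoc[symmetric] hh using uU by simp
    have l: "(inv\<^bsub>?R\<^esub> u \<odot> h) \<odot> h = \<one>\<^bsub>?R\<^esub>"
      unfolding mult_clifford_assoc hh using uU by simp
    have "inv\<^bsub>?R\<^esub> u \<odot> h = h \<odot> inv\<^bsub>?R\<^esub> u"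
      by (rule clifford.inv_unique[OF l r hC mult_clifford_closed mult_clifford_closed])
    with l r have "\<exists>x\<in>?C. x \<odot> h = \<one>\<^bsub>?R\<^esub> \<and> h \<odot> x = \<one>\<^bsub>?R\<^esub>"
      using mult_clifford_closed by metis
    then show ?thesis using hC unfolding Units_def by blast
  qed
  have hH: "h \<in> H"
  proof -
    have "\<one>\<^bsub>?R\<^esub> \<in> center \<eta> n \<inter> even_subspace \<eta> n"
      by (auto simp: center_def even_subspace_iff grade_involution_one)
    then have "\<one>\<^bsub>?R\<^esub> \<in> H" using H unfolding reversible_subalgebra_def by blast
    moreover have "u \<in> H" using H VH WH unfolding u_def W_def reversible_subalgebra_def by blast
    ultimately show ?thesis using H unfolding h_def reversible_subalgebra_def by blast
  qed
  define k where "k = inv\<^bsub>?R\<^esub> h"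
  have kC: "k \<in> ?C" and kU: "k \<in> Units ?R" and hk: "h \<odot> k = \<one>\<^bsub>?R\<^esub>" "k \<odot> h = \<one>\<^bsub>?R\<^esub>"
    unfolding k_def using hU by (simp_all add: clifford.Units_inv_closed)
  have hrev: "reversion h = h"
  proof
    fix A
    have "reversion h A = 1 / 2 * (reversion \<one>\<^bsub>?R\<^esub> A + reversion u A)"
      by (simp add: h_def reversion_def scale_def clifford_simps algebra_simps)
    also have "\<dots> = h A"
      unfolding urev reversion_one by (simp add: h_def scale_def clifford_simps)
    finally show "reversion h A = h A" .
  qed
  have krev: "reversion k = k"
  proof (rule clifford.inv_unique[OF _ hk(1) hC reversion_closed[OF kC] kC])
    show "reversion k \<odot> h = \<one>\<^bsub>?R\<^esub>"
      using reversion_mult[where X = h and Y = k and \<eta> = \<eta> and n = n] hk reversion_one hrev by simp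
  qed
  have "reversion (T \<odot> k) \<odot> (T \<odot> k) = k \<odot> (W \<odot> k)"
    unfolding W_def reversion_mult krev by (simp add: mult_clifford_assoc)
  also have "\<dots> = k \<odot> (W0 \<odot> ((h \<odot> h) \<odot> k))"
    unfolding hh by (subst W_eq) (simp add: mult_clifford_assoc)
  also have "\<dots> = k \<odot> (h \<odot> W0)" using hk hC comm[OF hC] by (simp add: mult_clifford_assoc)
  also have "\<dots> = W0" using hk W0C by (simp add: mult_clifford_assoc[symmetric])
  finally have "T \<odot> k \<in> group_check_A \<eta> n"
    using T kU W0G W0U by (simp add: group_check_A_def invertibles_def)
  moreover have "T = (T \<odot> k) \<odot> h" using clifford.Units_closed[OF T] hk by (simp add: mult_clifford_assoc)
  moreover have "h \<in> invertibles \<eta> n H" using hH hU by (simp add: invertibles_def)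
  ultimately show ?thesis unfolding set_mult_def by blast
qed

lemma norm_in_subalgebra_mult:
  assumes H: "reversible_subalgebra H"
    and g: "g \<in> Units (clifford \<eta> n)" "reversion g \<odot> g \<in> H"
    and h: "h \<in> invertibles \<eta> n H"
  shows "g \<odot> h \<in> Units (clifford \<eta> n)"
    and "reversion (g \<odot> h) \<odot> (g \<odot> h) \<in> invertibles \<eta> n H"
proof -
  have hU: "h \<in> Units (clifford \<eta> n)" and hH: "h \<in> H" using h by (auto simp: invertibles_def)
  show gh: "g \<odot> h \<in> Units (clifford \<eta> n)" using g hU by simp
  have "reversion (g \<odot> h) \<odot> (g \<odot> h) = reversion h \<odot> ((reversion g \<odot> g) \<odot> h)"
    unfolding reversion_mult by (simp add: mult_clifford_assoc)
  also have "\<dots> \<in> H" using H g hH unfolding reversible_subalgebra_def by blast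
  finally show "reversion (g \<odot> h) \<odot> (g \<odot> h) \<in> invertibles \<eta> n H"
    using gh reversion_Units by (auto simp: invertibles_def)
qed

section \<open>Blades in the centralizers\<close>

text \<open>
  A generator outside \<open>A\<close> commutes with the blade of \<open>A\<close> only if the grade is even, and a
  non-null generator inside \<open>A\<close> only if it is odd.
\<close>

lemma centralizer_1_blade_cases:
  assumes "X \<in> centralizer \<eta> n 1" "X A \<noteq> 0"
  shows "(\<forall>i\<in>A. \<eta> i = 0) \<and> even (card A) \<or> A = {1..n} \<and> odd n"
proof -
  have A: "A \<subseteq> {1..n}" using assms by (simp add: centralizer_def carrier_clifford_iff)
  have P: "(\<exists>j\<in>A \<inter> {i}. \<eta> j = 0) \<or> even (card A * 1 + card (A \<inter> {i}))" if "i \<in> {1..n}" for i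
  proof -
    have "{i} \<subseteq> {1..n}" "card {i} = 1" using that by simp_all
    then show ?thesis using assms unfolding centralizer_iff by blast
  qed
  show ?thesis
  proof (cases "even (card A)")
    case True
    then have "\<eta> i = 0" if "i \<in> A" for i using P[of i] A that by auto
    then show ?thesis using True by blast
  next
    case False
    have "i \<in> A" if "i \<in> {1..n}" for i using P[OF that] False by (cases "i \<in> A") auto
    then have "A = {1..n}" using A by blast
    then show ?thesis using False by auto
  qed
qed

lemma center_eq_centralizer_1: "center \<eta> n = centralizer \<eta> n 1"
proof
  show "center \<eta> n \<subseteq> centralizer \<eta> n 1"
    by (auto simp: center_def centralizer_def grade_subspace_def)
  show "centralizer \<eta> n 1 \<subseteq> center \<eta> n"
  proof
    fix X assume X: "X \<in> centralizer \<eta> n 1"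
    have "(\<lambda>A. 1 * X A) \<odot> V = V \<odot> X" for V
    proof (rule mult_eq_of_blades)
      fix A B assume AB: "A \<subseteq> {1..n}" "B \<subseteq> {1..n}" "X A \<noteq> 0"
      then have fin: "finite A" "finite B" using finite_index by auto
      have "(\<exists>i\<in>A \<inter> B. \<eta> i = 0) \<or> even (card A * card B + card (A \<inter> B))"
        using centralizer_1_blade_cases[OF X AB(3)]
      proof
        assume "(\<forall>i\<in>A. \<eta> i = 0) \<and> even (card A)"
        then show ?thesis by (cases "A \<inter> B = {}") auto
      next
        assume "A = {1..n} \<and> odd n"
        moreover from this AB(2) have "A \<inter> B = B" by blast
        ultimately show ?thesis by simp
      qed
      then show "1 * blade_coeff \<eta> A B = blade_coeff \<eta> B A"
        using blade_coeff_commute_sign_iff[OF fin, of 0 \<eta>] by simp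
    qed
    then show "X \<in> center \<eta> n" using X by (auto simp: center_def centralizer_def)
  qed
qed

text \<open>
  Moving a generator of \<open>A\<close> past the blade of \<open>A\<close> costs one sign less than the grade, whereas the
  twist supplies one sign for each member of \<open>A\<close>. The two sides thus have opposite signs, and
  they agree only if the generator squares to zero.
\<close>

lemma twisted_centralizer_1_blade_null:
  assumes "X \<in> twisted_centralizer \<eta> n 1" "X A \<noteq> 0"
  shows "\<forall>i\<in>A. \<eta> i = 0"
proof
  fix i assume i: "i \<in> A"
  have "A \<subseteq> {1..n}" using assms by (simp add: twisted_centralizer_def carrier_clifford_iff)
  then have "(\<exists>j\<in>A \<inter> {i}. \<eta> j = 0) \<or> even (card A + card A * 1 + card (A \<inter> {i}))"
  proof -
    assume "A \<subseteq> {1..n}"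
    then have "{i} \<subseteq> {1..n}" "card {i} = 1" using i by auto
    then show ?thesis using assms unfolding twisted_centralizer_iff by blast
  qed
  then show "\<eta> i = 0" using i by auto
qed

text \<open>
  A product \<open>e\<^sub>i e\<^sub>k\<close> anticommutes with the blade of \<open>A\<close> if exactly one of \<open>i, k\<close> lies in \<open>A\<close>, and both
  products are nonzero if that one is not null.
\<close>

lemma centralizer_2_blade_cases:
  assumes "X \<in> centralizer \<eta> n 2" "X A \<noteq> 0"
  shows "(\<forall>i\<in>A. \<eta> i = 0) \<or> A = {1..n}"
proof (rule ccontr)
  assume "\<not> ?thesis"
  moreover have "A \<subseteq> {1..n}" using assms by (simp add: centralizer_def carrier_clifford_iff)
  ultimately obtain i k where ik: "i \<in> A" "\<eta> i \<noteq> 0" "k \<in> {1..n}" "k \<notin> A" "i \<in> {1..n}" by blast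
  then have "card {i, k} = 2" "{i, k} \<subseteq> {1..n}" by (auto simp: card_insert_if)
  then have "(\<exists>j\<in>A \<inter> {i, k}. \<eta> j = 0) \<or> even (card A * 2 + card (A \<inter> {i, k}))"
    using assms unfolding centralizer_iff by blast
  then show False using ik by auto
qed

text \<open>
  Overlapping blades of this kind share a null generator. Disjoint ones are both of odd grade
  with null generators only, and blades of odd grade without common generators anticommute.
\<close>

lemma null_or_full_blades_anticommute:
  assumes null: "\<exists>i\<in>{1..n}. \<eta> i = 0"
    and A: "(\<forall>i\<in>A. \<eta> i = 0) \<or> A = {1..n}" "\<not> ((\<forall>i\<in>A. \<eta> i = 0) \<and> even (card A))"
    and B: "(\<forall>i\<in>B. \<eta> i = 0) \<or> B = {1..n}" "\<not> ((\<forall>i\<in>B. \<eta> i = 0) \<and> even (card B))"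
    and sub: "A \<subseteq> {1..n}" "B \<subseteq> {1..n}"
  shows "(\<exists>i\<in>A \<inter> B. \<eta> i = 0) \<or> odd (card A * card B + card (A \<inter> B))"
proof (cases "A \<inter> B = {}")
  case True
  have "C \<noteq> {}" if "\<not> ((\<forall>i\<in>C. \<eta> i = 0) \<and> even (card C))" for C using that by auto
  then have "A \<noteq> {1..n}" "B \<noteq> {1..n}" using True A(2) B(2) sub by blast+
  then have "odd (card A)" "odd (card B)" using A B by blast+
  then show ?thesis using True by simp
next
  case False
  then show ?thesis using null A(1) B(1) by blast
qed

text \<open>
  A blade of grade 3 anticommutes with a blade of even grade if the two share one or three
  generators, so one of these must then be null. Completing a non-null \<open>i \<in> A\<close> to three generators, by two outside \<open>A\<close> or by two
  inside \<open>A\<close>, shows that \<open>A\<close> omits at most one index and that of any two further members of \<open>A\<close>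
  one is null.
\<close>

lemma even_centralizer_3_blade:
  assumes X: "X \<in> centralizer \<eta> n 3" "X A \<noteq> 0" and even: "even (card A)"
    and i: "i \<in> A" "\<eta> i \<noteq> 0"
  shows "k \<in> {1..n} \<Longrightarrow> l \<in> {1..n} \<Longrightarrow> k \<notin> A \<Longrightarrow> l \<notin> A \<Longrightarrow> k = l"
    and "j \<in> A \<Longrightarrow> k \<in> A \<Longrightarrow> j \<noteq> i \<Longrightarrow> k \<noteq> i \<Longrightarrow> j \<noteq> k \<Longrightarrow> \<eta> j = 0 \<or> \<eta> k = 0"
proof -
  have A: "A \<subseteq> {1..n}" using X by (simp add: centralizer_def carrier_clifford_iff)
  have P: "(\<exists>j\<in>A \<inter> B. \<eta> j = 0) \<or> even (card A * 3 + card (A \<inter> B))"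
    if "B \<subseteq> {1..n}" "card B = 3" for B
    using X that unfolding centralizer_iff by blast
  show "k = l" if kl: "k \<in> {1..n}" "l \<in> {1..n}" "k \<notin> A" "l \<notin> A"
  proof (rule ccontr)
    assume "k \<noteq> l"
    then have "card {i, k, l} = 3" using i kl by (auto simp: card_insert_if)
    moreover have "{i, k, l} \<subseteq> {1..n}" using i kl A by blast
    moreover have "A \<inter> {i, k, l} = {i}" using i kl by blast
    ultimately have "(\<exists>j\<in>{i}. \<eta> j = 0) \<or> even (card A * 3 + card {i})" using P by metis
    then show False using i even by simp
  qed
  show "\<eta> j = 0 \<or> \<eta> k = 0" if jk: "j \<in> A" "k \<in> A" "j \<noteq> i" "k \<noteq> i" "j \<noteq> k"
  proof -
    have "card {i, j, k} = 3" using jk by (auto simp: card_insert_if)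
    moreover have "{i, j, k} \<subseteq> {1..n}" using i jk A by blast
    moreover have "A \<inter> {i, j, k} = {i, j, k}" using i jk by blast
    ultimately have "(\<exists>j\<in>{i, j, k}. \<eta> j = 0) \<or> even (card A * 3 + 3)" using P by metis
    then show ?thesis using i even by simp
  qed
qed

text \<open>
  The grade of \<open>A\<close> is a positive multiple of 4 and \<open>B\<close> omits at most one index, so \<open>A\<close> and \<open>B\<close>
  have at least three common members. Two of them differ from a chosen non-null \<open>i \<in> A\<close>, and one
  of those two is null.
\<close>

lemma even_centralizer_3_blades_share_null:
  assumes X: "X \<in> centralizer \<eta> n 3" "X \<in> even_subspace \<eta> n" "reversion X = X"
    and A: "X A \<noteq> 0" "\<not> (\<forall>i\<in>A. \<eta> i = 0)"
    and B: "X B \<noteq> 0" "\<not> (\<forall>i\<in>B. \<eta> i = 0)"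
  shows "\<exists>i\<in>A \<inter> B. \<eta> i = 0"
proof -
  have sub: "A \<subseteq> {1..n}" using X A by (simp add: centralizer_def carrier_clifford_iff)
  then have fin: "finite A" by (rule finite_index)
  have ev: "even (card A)" "even (card B)" using X(2) A(1) B(1) by (auto simp: even_subspace_def)
  obtain i where i: "i \<in> A" "\<eta> i \<noteq> 0" using A(2) by blast
  obtain i' where i': "i' \<in> B" "\<eta> i' \<noteq> 0" using B(2) by blast
  have "card A mod 4 = 0" using grade_of_reversion_fixed[OF X(3) A(1)] ev(1) by presburger
  moreover have "card A \<noteq> 0" using i fin by auto
  ultimately have "card A \<ge> 4" by presburger
  moreover have "card (A - B) \<le> Suc 0"
  proof -
    have "k = l" if "k \<in> A - B" "l \<in> A - B" for k l
      using even_centralizer_3_blade(1)[OF X(1) B(1) ev(2) i', of k l] sub that by blast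
    then show ?thesis using card_le_Suc0_iff_eq[of "A - B"] fin by simp
  qed
  moreover have "card A = card (A \<inter> B) + card (A - B)" using fin by (rule card_Int_Diff)
  moreover have "card (A \<inter> B) - 1 \<le> card (A \<inter> B - {i})"
    using diff_card_le_card_Diff[of "{i}" "A \<inter> B"] by simp
  ultimately have "\<not> card (A \<inter> B - {i}) \<le> Suc 0" by linarith
  then obtain j k where "j \<in> A \<inter> B - {i}" "k \<in> A \<inter> B - {i}" "j \<noteq> k"
    using fin card_le_Suc0_iff_eq[of "A \<inter> B - {i}"] by blast
  then show ?thesis using even_centralizer_3_blade(2)[OF X(1) A(1) ev(1) i, of j k] by blast
qed

section \<open>The factorizations\<close>

lemma set_mult_subset_norm_in_subalgebra:
  assumes H: "reversible_subalgebra H"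
    and G: "\<And>g. g \<in> G \<Longrightarrow> g \<in> Units (clifford \<eta> n) \<and> reversion g \<odot> g \<in> H"
  shows "G <#>\<^bsub>clifford \<eta> n\<^esub> invertibles \<eta> n H \<subseteq>
    {T \<in> Units (clifford \<eta> n). reversion T \<odot> T \<in> invertibles \<eta> n H}"
proof
  fix T assume "T \<in> G <#>\<^bsub>clifford \<eta> n\<^esub> invertibles \<eta> n H"
  then obtain g h where gh: "g \<in> G" "h \<in> invertibles \<eta> n H" "T = g \<odot> h"
    unfolding set_mult_def by blast
  show "T \<in> {T \<in> Units (clifford \<eta> n). reversion T \<odot> T \<in> invertibles \<eta> n H}"
    using norm_in_subalgebra_mult[OF H _ _ gh(2), of g] G[OF gh(1)] gh(3) by blast
qed

lemma norm_of_check_A: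
  assumes "reversible_subalgebra H" "g \<in> group_check_A \<eta> n"
  shows "g \<in> Units (clifford \<eta> n) \<and> reversion g \<odot> g \<in> H"
  using assms even_grassmann_subset_center
  unfolding group_check_A_def invertibles_def reversible_subalgebra_def by blast

lemma group_check_A03_factorization:
  "group_check_A03 \<eta> n = group_check_A \<eta> n <#>\<^bsub>clifford \<eta> n\<^esub>
    invertibles \<eta> n (centralizer \<eta> n 3 \<inter> even_subspace \<eta> n)"
proof
  let ?H = "centralizer \<eta> n 3 \<inter> even_subspace \<eta> n"
  have H: "reversible_subalgebra ?H"
    by (intro reversible_subalgebra_Int reversible_subalgebra_centralizer reversible_subalgebra_even)
  show "group_check_A \<eta> n <#>\<^bsub>clifford \<eta> n\<^esub> invertibles \<eta> n ?H \<subseteq> group_check_A03 \<eta> n"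
    unfolding group_check_A03_def
    by (rule set_mult_subset_norm_in_subalgebra[OF H norm_of_check_A[OF H]])
  show "group_check_A03 \<eta> n \<subseteq> group_check_A \<eta> n <#>\<^bsub>clifford \<eta> n\<^esub> invertibles \<eta> n ?H"
  proof
    fix T assume "T \<in> group_check_A03 \<eta> n"
    then have T: "T \<in> Units (clifford \<eta> n)" and W: "reversion T \<odot> T \<in> ?H"
      by (auto simp: group_check_A03_def invertibles_def)
    have Wrev: "reversion (reversion T \<odot> T) = reversion T \<odot> T"
      by (simp add: reversion_mult reversion_reversion)
    have ev: "even (card A)" if "(reversion T \<odot> T) A \<noteq> 0" for A
      using W that by (simp add: even_subspace_def)
    show "T \<in> group_check_A \<eta> n <#>\<^bsub>clifford \<eta> n\<^esub> invertibles \<eta> n ?H"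
      by (rule factor_even_grassmann[OF H T W], rule disjI1,
          rule even_centralizer_3_blades_share_null[OF _ _ Wrev]) (use W ev in blast)+
  qed
qed

lemma factorization_of_null_or_full:
  assumes null: "\<exists>i\<in>{1..n}. \<eta> i = 0" and H: "reversible_subalgebra H"
    and span: "\<And>X A. X \<in> H \<Longrightarrow> X A \<noteq> 0 \<Longrightarrow> (\<forall>i\<in>A. \<eta> i = 0) \<or> A = {1..n}"
  shows "{T \<in> Units (clifford \<eta> n). reversion T \<odot> T \<in> invertibles \<eta> n H} =
    group_check_A \<eta> n <#>\<^bsub>clifford \<eta> n\<^esub> invertibles \<eta> n H"
proof
  show "group_check_A \<eta> n <#>\<^bsub>clifford \<eta> n\<^esub> invertibles \<eta> n H \<subseteq>
      {T \<in> Units (clifford \<eta> n). reversion T \<odot> T \<in> invertibles \<eta> n H}"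
    by (rule set_mult_subset_norm_in_subalgebra[OF H norm_of_check_A[OF H]])
  show "{T \<in> Units (clifford \<eta> n). reversion T \<odot> T \<in> invertibles \<eta> n H} \<subseteq>
      group_check_A \<eta> n <#>\<^bsub>clifford \<eta> n\<^esub> invertibles \<eta> n H"
  proof
    fix T assume "T \<in> {T \<in> Units (clifford \<eta> n). reversion T \<odot> T \<in> invertibles \<eta> n H}"
    then have T: "T \<in> Units (clifford \<eta> n)" and W: "reversion T \<odot> T \<in> H"
      by (auto simp: invertibles_def)
    show "T \<in> group_check_A \<eta> n <#>\<^bsub>clifford \<eta> n\<^esub> invertibles \<eta> n H"
    proof (rule factor_even_grassmann[OF H T W])
      fix A B assume AB: "A \<subseteq> {1..n}" "B \<subseteq> {1..n}"
        and nz: "(reversion T \<odot> T) A \<noteq> 0" "(reversion T \<odot> T) B \<noteq> 0"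
        and "\<not> ((\<forall>i\<in>A. \<eta> i = 0) \<and> even (card A))" "\<not> ((\<forall>i\<in>B. \<eta> i = 0) \<and> even (card B))"
      then show "(\<exists>i\<in>A \<inter> B. \<eta> i = 0) \<or> odd (card A * card B + card (A \<inter> B))"
        using null_or_full_blades_anticommute[OF null span[OF W nz(1)] _ span[OF W nz(2)]] by blast
    qed
  qed
qed

lemma group_check_A12_factorization:
  assumes "\<exists>i\<in>{1..n}. \<eta> i = 0"
  shows "group_check_A12 \<eta> n = group_check_A \<eta> n <#>\<^bsub>clifford \<eta> n\<^esub>
    invertibles \<eta> n (twisted_centralizer \<eta> n 1 \<inter> twisted_centralizer \<eta> n 2)"
  unfolding group_check_A12_def
proof (rule factorization_of_null_or_full[OF assms])
  show "reversible_subalgebra (twisted_centralizer \<eta> n 1 \<inter> twisted_centralizer \<eta> n 2)"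
    by (intro reversible_subalgebra_Int reversible_subalgebra_twisted_centralizer)
qed (use twisted_centralizer_1_blade_null in blast)

lemma group_A01_factorization:
  assumes "\<exists>i\<in>{1..n}. \<eta> i = 0"
  shows "group_A01 \<eta> n = group_check_A \<eta> n <#>\<^bsub>clifford \<eta> n\<^esub> invertibles \<eta> n (center \<eta> n)"
  unfolding group_A01_def center_eq_centralizer_1
proof (rule factorization_of_null_or_full[OF assms])
  show "reversible_subalgebra (centralizer \<eta> n 1)" by (rule reversible_subalgebra_centralizer)
qed (use centralizer_1_blade_cases in blast)

text \<open>
  Here the left factor produced by the square root lies even in the smaller group
  \<open>group_check_A\<close>.
\<close>

lemma group_A23_factorization:
  assumes "\<exists>i\<in>{1..n}. \<eta> i = 0"
  shows "group_A23 \<eta> n = group_A01 \<eta> n <#>\<^bsub>clifford \<eta> n\<^esub>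
    invertibles \<eta> n (centralizer \<eta> n 2 \<inter> centralizer \<eta> n 3)"
proof
  let ?H = "centralizer \<eta> n 2 \<inter> centralizer \<eta> n 3"
  have H: "reversible_subalgebra ?H"
    by (intro reversible_subalgebra_Int reversible_subalgebra_centralizer)
  have "group_A23 \<eta> n = group_check_A \<eta> n <#>\<^bsub>clifford \<eta> n\<^esub> invertibles \<eta> n ?H"
    unfolding group_A23_def
    by (rule factorization_of_null_or_full[OF assms H]) (use centralizer_2_blade_cases in blast)
  moreover have "group_check_A \<eta> n \<subseteq> group_A01 \<eta> n"
    using even_grassmann_subset_center
    unfolding group_check_A_def group_A01_def invertibles_def center_eq_centralizer_1 by blast
  ultimately show "group_A23 \<eta> n \<subseteq> group_A01 \<eta> n <#>\<^bsub>clifford \<eta> n\<^esub> invertibles \<eta> n ?H"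
    unfolding set_mult_def by blast
  have "center \<eta> n \<subseteq> ?H" by (auto simp: center_def centralizer_def grade_subspace_def)
  then have "g \<in> Units (clifford \<eta> n) \<and> reversion g \<odot> g \<in> ?H"
    if "g \<in> group_A01 \<eta> n" for g
    using that by (auto simp: group_A01_def invertibles_def center_eq_centralizer_1)
  then show "group_A01 \<eta> n <#>\<^bsub>clifford \<eta> n\<^esub> invertibles \<eta> n ?H \<subseteq> group_A23 \<eta> n"
    unfolding group_A23_def by (rule set_mult_subset_norm_in_subalgebra[OF H])
qed

end

theorem theorem5p8:
  fixes p q r n :: nat
  assumes "p + q + r = n" and "n \<ge> 1" and "r \<noteq> 0"
  shows "(group_check_A03 (metric_real p q) n =
        group_check_A (metric_real p q) n <#>\<^bsub>clifford (metric_real p q) n\<^esub>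
        invertibles (metric_real p q) n
          (centralizer (metric_real p q) n 3 \<inter> even_subspace (metric_real p q) n)) \<and>
     (group_check_A12 (metric_real p q) n =
        group_check_A (metric_real p q) n <#>\<^bsub>clifford (metric_real p q) n\<^esub>
        invertibles (metric_real p q) n
          (twisted_centralizer (metric_real p q) n 1 \<inter> twisted_centralizer (metric_real p q) n 2)) \<and>
     (group_A23 (metric_real p q) n =
        group_A01 (metric_real p q) n <#>\<^bsub>clifford (metric_real p q) n\<^esub>
        invertibles (metric_real p q) n
          (centralizer (metric_real p q) n 2 \<inter> centralizer (metric_real p q) n 3)) \<and>
     (group_A01 (metric_real p q) n =
        group_check_A (metric_real p q) n <#>\<^bsub>clifford (metric_real p q) n\<^esub>
        invertibles (metric_real p q) n (center (metric_real p q) n)) \<and>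
     (group_check_A03 (metric_complex p q) n =
        group_check_A (metric_complex p q) n <#>\<^bsub>clifford (metric_complex p q) n\<^esub>
        invertibles (metric_complex p q) n
          (centralizer (metric_complex p q) n 3 \<inter> even_subspace (metric_complex p q) n)) \<and>
     (group_check_A12 (metric_complex p q) n =
        group_check_A (metric_complex p q) n <#>\<^bsub>clifford (metric_complex p q) n\<^esub>
        invertibles (metric_complex p q) n
          (twisted_centralizer (metric_complex p q) n 1 \<inter> twisted_centralizer (metric_complex p q) n 2)) \<and>
     (group_A23 (metric_complex p q) n =
        group_A01 (metric_complex p q) n <#>\<^bsub>clifford (metric_complex p q) n\<^esub>
        invertibles (metric_complex p q) n
          (centralizer (metric_complex p q) n 2 \<inter> centralizer (metric_complex p q) n 3)) \<and>
     (group_A01 (metric_complex p q) n =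
        group_check_A (metric_complex p q) n <#>\<^bsub>clifford (metric_complex p q) n\<^esub>
        invertibles (metric_complex p q) n (center (metric_complex p q) n))"
proof -
  have n: "n \<in> {1..n}" using assms by auto
  have "metric_real p q n = 0" "metric_complex p q n = 0"
    using assms by (auto simp: metric_real_def metric_complex_def)
  with n have "\<exists>i\<in>{1..n}. metric_real p q i = 0" "\<exists>i\<in>{1..n}. metric_complex p q i = 0"
    by blast+
  then show ?thesis
    by (intro conjI group_check_A03_factorization group_check_A12_factorization
        group_A23_factorization group_A01_factorization)
qed

end
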